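(* Let $d\ge 2$ and let $C\in\mathcal{C}^d$ be a closed convex cone in $\mathbb{R}^d$. Let $f:\mathbb{R}_+^2\to\mathbb{R}_+$ be a measurable function such that $$\varphi_f(C,\eta):=\mathbb{E}\left[f(\|\Pi_C(\mathbf{g})\|^2,\|\Pi_{C^\circ}(\mathbf{g})\|^2)\cdot\mathbf{1}_\eta(\Pi_C(\mathbf{g}),\Pi_{C^\circ}(\mathbf{g}))\right]$$ is finite for all $\eta\in\widehat{\mathcal{B}}(\mathbb{R}^d\times\mathbb{R}^d)$. Then $$\varphi_f(C,\eta)=\sum_{k=0}^d I_k(f)\cdot\Omega_k(C,\eta)\qquad\text{for all }\eta\in\widehat{\mathcal{B}}(\mathbb{R}^d\times\mathbb{R}^d),$$ where the coefficients are given by $I_k(f)=\varphi_f(L_k,\mathbb{R}^d\times\mathbb{R}^d)$ with an arbitrary $k$-dimensional linear subspace $L_k$ of $\mathbb{R}^d$. Explicitly, $$I_k(f)=\frac{\omega_k\omega_{d-k}}{(2\pi)^{d/2}}\int_0^\infty\int_0^\infty f(r^2,s^2)\,e^{-\frac12(r^2+s^2)}\,r^{k-1}s^{d-k-1}\,\mathrm{d}s\,\mathrm{d}r$$ for $k=1,\dots,d-1$, and $$I_0(f)=\frac{\omega_d}{(2\pi)^{d/2}}\int_0^\infty f(0,s^2)\,e^{-\frac12 s^2}s^{d-1}\,\mathrm{d}s,\qquad I_d(f)=\frac{\omega_d}{(2\pi)^{d/2}}\int_0^\infty f(r^2,0)\,e^{-\frac12 r^2}r^{d-1}\,\mathrm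{d}r.$$
   Context: $\mathbb{R}^d$ carries its standard scalar product $\langle\cdot,\cdot\rangle$ and norm $\|\cdot\|$; $o$ is the origin; $\mathbb{R}_+=[0,\infty)$; $\omega_n=2\pi^{n/2}/\Gamma(n/2)$. $\mathbf{g}$ is a standard Gaussian random vector in $\mathbb{R}^d$, $\mathbb{P}$ denotes probability, $\mathbb{E}$ expectation, and $\gamma_d$ is the standard Gaussian measure on $\mathbb{R}^d$. $\mathbf{1}_\eta$ is the indicator function of $\eta$. The convention $0\cdot\infty=0$ is used. $\mathcal{C}^d$ is the set of closed convex cones with apex $o$ in $\mathbb{R}^d$ (all contain $o$), and $\mathcal{C}^d_*=\mathcal{C}^d\setminus\{\{o\}\}$. The dual cone of $C$ is $C^\circ=\{x\in\mathbb{R}^d:\langle x,y\rangle\le 0\text{ for all }y\in C\}$. $\Pi_C:\mathbb{R}^d\to C$ is the nearest-point map (metric projection) onto $C$. The biconic $\sigma$-algebra $\widehat{\mathcal{B}}(\mathbb{R}^d\times\mathbb{R}^d)$ consists of the Borel sets $\eta\subseteq\mathbb{R}^d\times\mathbb{R}^d$ such that $(\lambda x,\mu y)\in\eta$ whenever $(x,y)\in\eta$ and $\lambda,\mu>0$. For $C\in\mathcal{C}^d_*$, the angular distance is $d_a(x,C)=\arccos(\|\Pi_C(x)\|/\|x\|)$ for $x\ne o$, and $d_a(o,C)=\pi/2$. For $0\le\lambda<\pi/2$ and $\eta\in\widehat{\mathcal{B}}(\mathbb{R}^d\times\mathbb{R}^d)$, the angular local parallel set is $$M^a_\lambda(C,\eta)=\{x\in\mathbb{R}^d: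 d_a(x,C)\le\lambda,\ (\Pi_C(x),\Pi_{C^\circ}(x))\in\eta\}.$$ Conic support measures. The conic support measures $\Omega_0(C,\cdot),\dots,\Omega_d(C,\cdot)$ are finite measures on $\widehat{\mathcal{B}}(\mathbb{R}^d\times\mathbb{R}^d)$. For $C\in\mathcal{C}^d_*$ it is known (local Steiner formula) that there exist finite measures $\Omega_1(C,\cdot),\dots,\Omega_d(C,\cdot)$, uniquely determined by the requirement that $$\gamma_d(M^a_\lambda(C,\eta))=\sum_{k=1}^d g_k(\lambda)\,\Omega_k(C,\eta)\quad\text{for all }\eta\in\widehat{\mathcal{B}}(\mathbb{R}^d\times\mathbb{R}^d),\ 0\le\lambda<\pi/2,$$ where $g_k(\lambda)=\frac{\omega_k\omega_{d-k}}{\omega_d}\int_0^\lambda\cos^{k-1}\varphi\,\sin^{d-k-1}\varphi\,\mathrm{d}\varphi$ for $k=1,\dots,d-1$ and $g_d\equiv 1$. Moreover $\Omega_0(C,\eta)=\mathbb{P}\{\Pi_C(\mathbf{g})=o,\ (\Pi_C(\mathbf{g}),\Pi_{C^\circ}(\mathbf{g}))\in\eta\}$. For $C=\{o\}$, $\Omega_0(C,\cdot)$ is given by the same formula, and $\Omega_k(C,\cdot)=0$ for $k\ge 1$. For polyhedral $C$ these measures coincide with the paper's original definition $\Omega_k(C,\eta)=\mathbb{P}\{\Pi_C(\mathbf{g})\in\mathrm{skel}_kC,\ (\Pi_C(\mathbf{g}),\Pi_{C^\circ}(\mathbf{g}))\in\eta\}$, where $\mathrm{skel}_kC$ is the union of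 the relative interiors of the $k$-dimensional faces of $C$. *)

theory Defs
  imports "HOL-Analysis.Analysis"
begin

definition omega :: "nat \<Rightarrow> real"
  where "omega n = 2 * pi powr (real n / 2) / Gamma (real n / 2)"

definition gaussian :: "'a::euclidean_space measure"
  where "gaussian = density lborel
    (\<lambda>x. ennreal ((2 * pi) powr (- real DIM('a) / 2) * exp (- (norm x)\<^sup>2 / 2)))"

definition dual_cone :: "'a::real_inner set \<Rightarrow> 'a set"
  where "dual_cone C = {x. \<forall>y\<in>C. x \<bullet> y \<le> 0}"

definition biconic_sets :: "('a::euclidean_space \<times> 'a) set set"
  where "biconic_sets = {\<eta> \<in> sets borel.
    \<forall>x y. \<forall>l>0. \<forall>m>0. (x, y) \<in> \<eta> \<longrightarrow> (l *\<^sub>R x, m *\<^sub>R y) \<in> \<eta>}"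

lemma sigma_algebra_biconic_sets:
  "sigma_algebra UNIV (biconic_sets :: ('a::euclidean_space \<times> 'a) set set)"
proof (subst sigma_algebra_iff2, intro conjI ballI allI impI)
  fix \<eta> :: "('a \<times> 'a) set" assume \<eta>: "\<eta> \<in> biconic_sets"
  have "(l *\<^sub>R x, m *\<^sub>R y) \<notin> \<eta>" if "l > 0" "m > 0" "(x, y) \<notin> \<eta>" for l m :: real and x y
  proof
    assume "(l *\<^sub>R x, m *\<^sub>R y) \<in> \<eta>"
    moreover have "inverse l > 0" "inverse m > 0" using that by auto
    ultimately have "(inverse l *\<^sub>R l *\<^sub>R x, inverse m *\<^sub>R m *\<^sub>R y) \<in> \<eta>"
      using \<eta> unfolding biconic_sets_def by blast
    then show False using that by simp
  qed
  moreover have "UNIV - \<eta> \<in> sets borel"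
    using \<eta> by (auto simp: biconic_sets_def Compl_eq_Diff_UNIV[symmetric])
  ultimately show "UNIV - \<eta> \<in> biconic_sets"
    by (auto simp: biconic_sets_def)
next
  fix A :: "nat \<Rightarrow> ('a \<times> 'a) set" assume "range A \<subseteq> biconic_sets"
  then have A: "A i \<in> biconic_sets" for i by blast
  then have "(\<Union>i. A i) \<in> sets borel"
    by (intro sets.countable_UN) (auto simp: biconic_sets_def)
  then show "(\<Union>i. A i) \<in> biconic_sets"
    using A by (fastforce simp: biconic_sets_def)
qed (auto simp: biconic_sets_def)

definition angular_dist :: "'a::euclidean_space \<Rightarrow> 'a set \<Rightarrow> real"
  where "angular_dist x C =
    (if x = 0 then pi / 2 else arccos (norm (closest_point C x) / norm x))"

definition angular_parallel_set ::
    "real \<Rightarrow> 'a::euclidean_space set \<Rightarrow> ('a \<times> 'a) set \<Rightarrow> 'a set"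
  where "angular_parallel_set l C \<eta> = {x. angular_dist x C \<le> l \<and>
    (closest_point C x, closest_point (dual_cone C) x) \<in> \<eta>}"

definition steiner_coeff :: "nat \<Rightarrow> nat \<Rightarrow> real \<Rightarrow> real"
  where "steiner_coeff d k l = (if k = d then 1 else
    omega k * omega (d - k) / omega d *
    integral {0..l} (\<lambda>\<phi>. cos \<phi> ^ (k - 1) * sin \<phi> ^ (d - k - 1)))"

text \<open>
  The conic support measures of \<open>C\<close> are the finite measures \<open>\<Omega> 0, \<dots>, \<Omega> d\<close> on the biconic
  \<open>\<sigma>\<close>-algebra characterised by the following predicate: for \<open>C \<noteq> {0}\<close> the measures of positive
  index are defined as the coefficients of the local Steiner formula, which determines
  them uniquely. The values \<open>\<Omega> k\<close> for \<open>k > d\<close> are irrelevant.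
\<close>
definition conic_support_measures ::
    "'a::euclidean_space set \<Rightarrow> (nat \<Rightarrow> ('a \<times> 'a) measure) \<Rightarrow> bool"
  where "conic_support_measures C \<Omega> \<longleftrightarrow>
    (\<forall>k\<le>DIM('a). finite_measure (\<Omega> k) \<and> sets (\<Omega> k) = biconic_sets) \<and>
    (\<forall>\<eta>\<in>biconic_sets. measure (\<Omega> 0) \<eta> = measure gaussian
      {x. closest_point C x = 0 \<and> (closest_point C x, closest_point (dual_cone C) x) \<in> \<eta>}) \<and>
    (if C = {0} then \<forall>k\<in>{1..DIM('a)}. \<forall>\<eta>\<in>biconic_sets. measure (\<Omega> k) \<eta> = 0
     else \<forall>\<eta>\<in>biconic_sets. \<forall>l. 0 \<le> l \<and> l < pi / 2 \<longrightarrow>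
       measure gaussian (angular_parallel_set l C \<eta>) =
         (\<Sum>k=1..DIM('a). steiner_coeff DIM('a) k l * measure (\<Omega> k) \<eta>))"

text \<open>
  The expectation of a nonnegative variable, with values in \<open>[0, \<infinity>]\<close>; the convention
  \<open>0 * \<infinity> = 0\<close> holds in type \<^typ>\<open>ennreal\<close>.
\<close>
definition phi ::
    "(real \<times> real \<Rightarrow> real) \<Rightarrow> 'a::euclidean_space set \<Rightarrow> ('a \<times> 'a) set \<Rightarrow> ennreal"
  where "phi f C \<eta> = (\<integral>\<^sup>+x.
    ennreal (f ((norm (closest_point C x))\<^sup>2, (norm (closest_point (dual_cone C) x))\<^sup>2)) *
    indicator \<eta> (closest_point C x, closest_point (dual_cone C) x) \<partial>gaussian)"

end

theory Submission
  imports Defs "HOL-Probability.Distributions"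
begin

text \<open>
  Let \<open>P x\<close> and \<open>Q x\<close> be the projections of \<open>x\<close> to the cone \<open>C\<close> and to its dual cone. They are
  orthogonal with sum \<open>x\<close>, so \<open>norm (P x)\<close> and \<open>norm (Q x)\<close> can be recovered from \<open>norm x\<close> and from
  \<open>t x = norm (Q x) / norm (P x)\<close>, the tangent of the angular distance of \<open>x\<close> from \<open>C\<close>. Both
  projections are positively homogeneous. Hence, for a biconic set \<open>\<eta>\<close>, the set of points \<open>x\<close>
  with \<open>(P x, Q x) \<in> \<eta>\<close> is a cone, and \<open>t\<close> is constant on rays.

  For a Gaussian vector, norm and direction are independent (\<open>gaussian_cone_radial\<close>,
  \<open>gaussian_cone_independence\<close>). The integral over such a cone is therefore determined by
  the law of \<open>t\<close> alone, and the local Steiner formula is exactly the distribution function of \<open>t\<close>,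
  with the conic support measures as coefficients (\<open>tangent_law\<close>). The result is a linear
  combination of \<open>\<Omega> k \<eta>\<close> whose coefficients depend on the dimension and on \<open>f\<close>, but not on \<open>C\<close>
  or \<open>\<eta>\<close> (\<open>projection_integral_decomposition\<close>). Here the index \<open>0\<close> collects the points with \<open>P x = 0\<close>, where
  \<open>t\<close> is not defined, and the index \<open>DIM('a)\<close> those with \<open>t x = 0\<close>; polar coordinates in the plane
  (\<open>nn_integral_polar_tan\<close>) rewrite the other coefficients as the stated double integrals.

  That these coefficients are the values at linear subspaces is computed directly
  (\<open>projection_integral_subspace\<close>): Lebesgue measure is invariant under rotations
  (\<open>lborel_distr_orthogonal\<close>), so the subspace may be assumed to be spanned by standard basis
  vectors, and the norms of the two projections are then governed by separate coordinates.
\<close>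

section \<open>Metric projections onto a cone and its dual\<close>

text \<open>
  The variational inequality that characterises a nearest point, tested only along the ray
  through that point, turns into orthogonality; the decomposition of a point and the homogeneity of the
  projection then only require inner products to be checked.
\<close>
lemma closest_point_cone_iff:
  fixes C :: "'a::euclidean_space set"
  assumes "closed C" "convex_cone C"
  shows "closest_point C x = p \<longleftrightarrow> p \<in> C \<and> x - p \<in> dual_cone C \<and> (x - p) \<bullet> p = 0"
proof -
  have conv: "convex C" and ne: "C \<noteq> {}" using assms(2) by (auto simp: convex_cone_def)
  show ?thesis
  proof
    assume p: "closest_point C x = p"
    have pC: "p \<in> C" using closest_point_in_set[OF assms(1) ne] p by auto
    have dot: "(x - p) \<bullet> (y - p) \<le> 0" if "y \<in> C" for y
      using closest_point_dot[OF conv assms(1) that, of x] p by simp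
    \<comment> \<open>comparing \<open>p\<close> with the points \<open>0\<close> and \<open>2 p\<close> of its ray\<close>
    have "0 \<in> C" "2 *\<^sub>R p \<in> C" using assms(2) pC by (auto simp: convex_cone_iff)
    then have 0: "(x - p) \<bullet> p = 0"
      using dot[of 0] dot[of "2 *\<^sub>R p"] by (auto simp: inner_simps algebra_simps)
    then have "(x - p) \<bullet> y \<le> 0" if "y \<in> C" for y
      using dot[OF that] by (simp add: inner_simps algebra_simps)
    then show "p \<in> C \<and> x - p \<in> dual_cone C \<and> (x - p) \<bullet> p = 0"
      using pC 0 by (simp add: dual_cone_def)
  next
    assume R: "p \<in> C \<and> x - p \<in> dual_cone C \<and> (x - p) \<bullet> p = 0"
    have "dist x p \<le> dist x z" if z: "z \<in> C" for z
    proof -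
      have "(x - p) \<bullet> z \<le> 0" using R z by (auto simp: dual_cone_def)
      then have "(x - p) \<bullet> (p - z) \<ge> 0" using R by (simp add: inner_simps)
      moreover have "(norm (x - z))\<^sup>2 = (norm (x - p))\<^sup>2 + 2 * ((x - p) \<bullet> (p - z)) + (norm (p - z))\<^sup>2"
        unfolding power2_norm_eq_inner by (simp add: inner_simps inner_commute algebra_simps)
      ultimately have "(norm (x - p))\<^sup>2 \<le> (norm (x - z))\<^sup>2"
        using zero_le_power2[of "norm (p - z)"] by linarith
      then show ?thesis by (simp add: dist_norm)
    qed
    then show "closest_point C x = p"
      using closest_point_unique[OF conv assms(1), of p x] R by auto
  qed
qed

lemma dual_cone_convex_cone: "convex_cone (dual_cone C)"
  by (auto simp: dual_cone_def convex_cone_iff inner_simps mult_nonneg_nonpos add_nonpos_nonpos)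

lemma dual_cone_closed: "closed (dual_cone C)"
proof -
  have "dual_cone C = (\<Inter>y\<in>C. {x. x \<bullet> y \<le> 0})" by (auto simp: dual_cone_def)
  also have "closed \<dots>" by (intro closed_INT ballI closed_Collect_le continuous_intros)
  finally show ?thesis .
qed

lemma moreau_decomposition:
  fixes C :: "'a::euclidean_space set"
  assumes "closed C" "convex_cone C"
  shows "closest_point (dual_cone C) x = x - closest_point C x"
proof -
  define p where "p = closest_point C x"
  have "p \<in> C" "x - p \<in> dual_cone C" "(x - p) \<bullet> p = 0"
    using closest_point_cone_iff[OF assms, of x p] p_def by auto
  moreover from this have "p \<in> dual_cone (dual_cone C)"
    by (auto simp: dual_cone_def inner_commute)
  ultimately show ?thesis
    using closest_point_cone_iff[OF dual_cone_closed dual_cone_convex_cone, of C x "x - p"]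
    by (simp add: p_def inner_commute)
qed

lemma closest_point_cone_scaleR:
  fixes C :: "'a::euclidean_space set"
  assumes "closed C" "convex_cone C" "c > 0"
  shows "closest_point C (c *\<^sub>R x) = c *\<^sub>R closest_point C x"
proof -
  have "closest_point C x \<in> C \<and> x - closest_point C x \<in> dual_cone C \<and> (x - closest_point C x) \<bullet> closest_point C x = 0"
    using closest_point_cone_iff[OF assms(1,2), of x] by blast
  then have "c *\<^sub>R closest_point C x \<in> C \<and> c *\<^sub>R x - c *\<^sub>R closest_point C x \<in> dual_cone C
     \<and> (c *\<^sub>R x - c *\<^sub>R closest_point C x) \<bullet> (c *\<^sub>R closest_point C x) = 0"
    using assms convex_cone_scaleR[OF assms(2), of c] convex_cone_scaleR[OF dual_cone_convex_cone, of c _ C]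
    by (auto simp flip: scaleR_diff_right)
  then show ?thesis using closest_point_cone_iff[OF assms(1,2)] by blast
qed

lemma norm_sq_moreau:
  fixes C :: "'a::euclidean_space set"
  assumes "closed C" "convex_cone C"
  shows "(norm x)\<^sup>2 = (norm (closest_point C x))\<^sup>2 + (norm (closest_point (dual_cone C) x))\<^sup>2"
proof -
  have "(x - closest_point C x) \<bullet> closest_point C x = 0"
    using closest_point_cone_iff[OF assms, of x] by blast
  then show ?thesis unfolding moreau_decomposition[OF assms] power2_norm_eq_inner
    by (simp add: inner_simps inner_commute algebra_simps)
qed

lemma closest_point_measurable:
  fixes C :: "'a::euclidean_space set"
  assumes "closed C" "convex_cone C"
  shows "closest_point C \<in> borel_measurable borel"
  using assms by (intro borel_measurable_continuous_onI continuous_on_closest_point)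
    (auto simp: convex_cone_def)

section \<open>Laws determined by distribution functions\<close>

text \<open>
  A nonnegative random variable is determined by its distribution function, also under an
  infinite measure. All densities below (of norms and of the tangent of the angular distance)
  are found in this way: the measure of a sublevel set is known, and it is differentiated. The
  derivative at \<open>0\<close> is two-sided, so \<open>G\<close> has to be chosen smooth across \<open>0\<close>.
\<close>
lemma nn_integral_distribution_function:
  fixes N :: "'b \<Rightarrow> real" and h :: "real \<Rightarrow> ennreal"
  assumes N[measurable]: "N \<in> borel_measurable M" and N0: "\<And>x. x \<in> space M \<Longrightarrow> 0 \<le> N x"
    and g[measurable]: "g \<in> borel_measurable borel" and g0: "\<And>r. 0 \<le> r \<Longrightarrow> 0 \<le> g r"
    and G: "\<And>r. 0 \<le> r \<Longrightarrow> (G has_real_derivative g r) (at r)" "G 0 = 0"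
    and cdf: "\<And>a. 0 \<le> a \<Longrightarrow> emeasure M {x \<in> space M. N x \<le> a} = ennreal (G a)"
    and h[measurable]: "h \<in> borel_measurable borel"
  shows "(\<integral>\<^sup>+x. h (N x) \<partial>M) = (\<integral>\<^sup>+r\<in>{0..}. h r * ennreal (g r) \<partial>lborel)"
proof -
  let ?D = "density lborel (\<lambda>r. ennreal (g r) * indicator {0..} r)"
  have D: "emeasure ?D {..a} = emeasure (distr M borel N) {..a}" for a
  proof (cases "0 \<le> a")
    case True
    have "emeasure ?D {..a} = (\<integral>\<^sup>+r. ennreal (g r) * indicator {0..a} r \<partial>lborel)"
      by (subst emeasure_density) (auto intro!: nn_integral_cong simp: indicator_def)
    also have "\<dots> = ennreal (G a)"
      using nn_integral_FTC_Icc[of g 0 a G] G g0 True by auto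
    also have "\<dots> = emeasure (distr M borel N) {..a}"
      by (subst emeasure_distr) (auto simp: cdf[OF True, symmetric] intro!: arg_cong[where f="emeasure M"])
    finally show ?thesis .
  next
    case False
    have "N -` {..a} \<inter> space M = {}" using N0 False by fastforce
    then have "emeasure (distr M borel N) {..a} = 0" by (simp add: emeasure_distr)
    moreover have "emeasure ?D {..a} = 0"
      using False by (subst emeasure_density) (auto intro!: nn_integral_zero' simp: indicator_def)
    ultimately show ?thesis by simp
  qed
  have fin: "emeasure (distr M borel N) {..real i} \<noteq> \<infinity>" for i :: nat
  proof -
    have "N -` {..real i} \<inter> space M = {x \<in> space M. N x \<le> real i}" by auto
    then show ?thesis using cdf[of "real i"] by (simp add: emeasure_distr)
  qed
  have "distr M borel N = ?D"
  proof (rule measure_eqI_generator_eq[where E="range atMost" and \<Omega>=UNIV and A="\<lambda>i::nat. {..real i}"])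
    show "Int_stable (range (atMost :: real \<Rightarrow> _))"
      by (auto simp: Int_stable_def)
    show "sets (distr M borel N) = sigma_sets UNIV (range atMost)" "sets ?D = sigma_sets UNIV (range atMost)"
      by (simp_all add: borel_eq_atMost)
    show "(\<Union>i. {..real i}) = UNIV" by (auto intro: real_arch_simple)
  qed (use D fin in auto)
  then have "(\<integral>\<^sup>+x. h x \<partial>distr M borel N) = (\<integral>\<^sup>+x. h x \<partial>?D)" by simp
  then show ?thesis
    by (simp add: nn_integral_distr nn_integral_density mult_ac)
qed

section \<open>Radial integration over cones against the Gaussian measure\<close>

lemma sets_gaussian[simp, measurable_cong]: "sets gaussian = sets borel"
  by (simp add: gaussian_def)

lemma space_gaussian[simp]: "space gaussian = UNIV"
  by (simp add: gaussian_def)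

lemma omega_unit_ball_vol:
  assumes "n > 0"
  shows "omega n = real n * unit_ball_vol (real n)"
proof -
  have "real n / 2 \<notin> \<int>\<^sub>\<le>\<^sub>0" using assms nonpos_Ints_nonpos[of "real n / 2"] by auto
  then show ?thesis
    using assms by (simp add: omega_def unit_ball_vol_def Gamma_plus1)
qed

lemma omega_pos: "n > 0 \<Longrightarrow> omega n > 0"
  by (simp add: omega_unit_ball_vol)

text \<open>
  The Gaussian density is the product of one-dimensional normal densities.
\<close>
lemma emeasure_gaussian_UNIV: "emeasure (gaussian :: 'a::euclidean_space measure) UNIV = 1"
proof -
  have std: "(\<integral>\<^sup>+x. ennreal (std_normal_density x) \<partial>lborel) = 1"
    using prob_space_normal_density[of 1 0] prob_space.emeasure_space_1
    by (fastforce simp: emeasure_density)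
  have "(\<Prod>b\<in>Basis. std_normal_density (x \<bullet> b))
     = (2 * pi) powr (- real DIM('a) / 2) * exp (- (norm x)\<^sup>2 / 2)" for x :: 'a
  proof -
    have "(1 / sqrt (2 * pi)) ^ DIM('a) = (2 * pi) powr (- real DIM('a) / 2)"
      by (simp add: powr_half_sqrt[symmetric] powr_minus powr_power  field_simps)
    moreover have "(\<Sum>b\<in>Basis. - (x \<bullet> b)\<^sup>2 / 2) = - (norm x)\<^sup>2 / 2"
      unfolding sum_divide_distrib[symmetric] sum_negf power2_norm_eq_inner euclidean_inner[of x x]
      by (simp add: power2_eq_square)
    ultimately show ?thesis
      unfolding std_normal_density_def prod.distrib prod_constant
      by (subst exp_sum[symmetric]) (simp_all del: power_divide)
  qed
  then have "emeasure (gaussian :: 'a measure) UNIV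
     = (\<integral>\<^sup>+x. (\<Prod>b\<in>Basis. ennreal (std_normal_density (x \<bullet> b))) \<partial>(lborel :: 'a measure))"
    by (simp add: gaussian_def emeasure_density prod_ennreal)
  also have "\<dots> = (\<Prod>b\<in>(Basis::'a set). (\<integral>\<^sup>+x. ennreal (std_normal_density x) \<partial>lborel))"
    by (subst nn_integral_lborel_prod) auto
  finally show ?thesis by (simp add: std)
qed

lemma prob_space_gaussian: "prob_space (gaussian :: 'a::euclidean_space measure)"
  by (rule prob_spaceI) (simp add: emeasure_gaussian_UNIV)

lemma emeasure_cone_Int_cball:
  fixes A :: "'a::euclidean_space set"
  assumes [measurable]: "A \<in> sets borel" and A: "\<And>c x. c > 0 \<Longrightarrow> x \<in> A \<Longrightarrow> c *\<^sub>R x \<in> A" and r: "r > 0"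
  shows "emeasure lborel (A \<inter> cball 0 r) = ennreal (r ^ DIM('a)) * emeasure lborel (A \<inter> cball 0 1)"
proof -
  have *: "(\<lambda>x. r *\<^sub>R x) -` (A \<inter> cball 0 r) = A \<inter> cball 0 1"
  proof -
    have "r *\<^sub>R x \<in> A \<longleftrightarrow> x \<in> A" for x
      using A[of r x] A[of "inverse r" "r *\<^sub>R x"] r by auto
    then show ?thesis using r by (auto simp: mult_le_cancel_left1)
  qed
  have "emeasure lborel (A \<inter> cball 0 r)
     = emeasure (density (distr lborel borel (\<lambda>x. 0 + r *\<^sub>R x)) (\<lambda>_. ennreal (\<bar>r\<bar> ^ DIM('a)))) (A \<inter> cball 0 r)"
    using lborel_affine[of r "0::'a"] r by simp
  also have "\<dots> = ennreal (r ^ DIM('a)) * emeasure lborel ((\<lambda>x. r *\<^sub>R x) -` (A \<inter> cball 0 r))"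
    using r by (simp add: emeasure_density nn_integral_cmult_indicator emeasure_distr del: vimage_Int)
  finally show ?thesis unfolding * .
qed

text \<open>
  The expectation of \<open>h (norm g)\<close> for a standard Gaussian vector \<open>g\<close>, written with the density
  of the chi distribution. The type argument carries the dimension.
\<close>
definition radial :: "'a::euclidean_space itself \<Rightarrow> (real \<Rightarrow> ennreal) \<Rightarrow> ennreal" where
  "radial _ h = ennreal (omega DIM('a) / (2 * pi) powr (real DIM('a) / 2)) *
     (\<integral>\<^sup>+r\<in>{0..}. h r * ennreal (exp (- r\<^sup>2 / 2) * r ^ (DIM('a) - 1)) \<partial>lborel)"

text \<open>
  Norm and direction of a Gaussian vector are independent. On a cone \<open>A\<close> the Lebesgue measure of
  \<open>A \<inter> cball 0 r\<close> is proportional to the power \<open>r ^ DIM('a)\<close>, so only the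
  constant depends on \<open>A\<close>; taking \<open>h = 1\<close> identifies that constant with the Gaussian measure
  of \<open>A\<close>.
\<close>
lemma gaussian_cone_radial:
  fixes A :: "'a::euclidean_space set"
  assumes A[measurable]: "A \<in> sets borel" and cone: "\<And>c x. c > 0 \<Longrightarrow> x \<in> A \<Longrightarrow> c *\<^sub>R x \<in> A"
    and h[measurable]: "h \<in> borel_measurable borel"
  shows "(\<integral>\<^sup>+x\<in>A. h (norm x) \<partial>gaussian) = emeasure gaussian A * radial TYPE('a) h"
proof -
  let ?d = "DIM('a)"
  define K where "K = (2 * pi) powr (- real ?d / 2)"
  define J where "J h = (\<integral>\<^sup>+r\<in>{0..}. h r * ennreal (exp (- r\<^sup>2 / 2) * r ^ (?d - 1)) \<partial>lborel)"
    for h :: "real \<Rightarrow> ennreal"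
  have K: "K > 0" by (simp add: K_def)
  have int: "(\<integral>\<^sup>+x\<in>A. h (norm x) \<partial>gaussian)
     = ennreal (real ?d * measure lborel (A \<inter> cball 0 1)) * ennreal K * J h"
    if [measurable]: "A \<in> sets borel" "h \<in> borel_measurable borel"
      and cone: "\<And>c x. c > 0 \<Longrightarrow> x \<in> A \<Longrightarrow> c *\<^sub>R x \<in> A"
    for A :: "'a set" and h :: "real \<Rightarrow> ennreal"
  proof -
    define \<kappa> where "\<kappa> = measure lborel (A \<inter> cball 0 1)"
    have fin: "emeasure lborel (A \<inter> cball 0 1) = ennreal \<kappa>"
      unfolding \<kappa>_def
    proof (rule emeasure_eq_ennreal_measure)
      have "emeasure lborel (A \<inter> cball 0 1) \<le> emeasure lborel (cball (0::'a) 1)"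
        by (intro emeasure_mono) auto
      also have "\<dots> < top" using emeasure_lborel_cball_finite by auto
      finally show "emeasure lborel (A \<inter> cball 0 1) \<noteq> top" by simp
    qed
    have \<kappa>0: "\<kappa> \<ge> 0" by (simp add: \<kappa>_def)
    have "(\<integral>\<^sup>+x\<in>A. h (norm x) \<partial>gaussian)
       = (\<integral>\<^sup>+x. ennreal K * (h (norm x) * ennreal (exp (- (norm x)\<^sup>2 / 2))) \<partial>density lborel (indicator A))"
      unfolding gaussian_def
      by (simp add: nn_integral_density K_def ennreal_mult' mult_ac)
    also have "\<dots> = ennreal K * (\<integral>\<^sup>+x. (h (norm x) * ennreal (exp (- (norm x)\<^sup>2 / 2))) \<partial>density lborel (indicator A))"
      by (rule nn_integral_cmult) measurable
    also have "(\<integral>\<^sup>+x. (h (norm x) * ennreal (exp (- (norm x)\<^sup>2 / 2))) \<partial>density lborel (indicator A))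
      = (\<integral>\<^sup>+r\<in>{0..}. (h r * ennreal (exp (- r\<^sup>2 / 2))) * ennreal (\<kappa> * real ?d * r ^ (?d - 1)) \<partial>lborel)"
    proof (rule nn_integral_distribution_function[where N=norm and G="\<lambda>r. \<kappa> * r ^ ?d"])
      fix a :: real assume a: "0 \<le> a"
      have "emeasure (density lborel (indicator A)) {x. norm x \<le> a} = emeasure lborel (A \<inter> cball 0 a)"
        by (subst emeasure_density)
           (auto simp: indicator_def nn_integral_indicator[symmetric] simp del: nn_integral_indicator intro!: nn_integral_cong)
      also have "\<dots> = ennreal (\<kappa> * a ^ ?d)"
      proof (cases "a = 0")
        case True
        have "emeasure lborel (A \<inter> cball 0 0) \<le> emeasure lborel {0::'a}"
          by (intro emeasure_mono) auto
        then show ?thesis using True by (simp add: zero_power)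
      next
        case False
        then show ?thesis using emeasure_cone_Int_cball[OF that(1) cone, of a] a \<kappa>0
          by (simp add: fin ennreal_mult' mult.commute)
      qed
      finally show "emeasure (density lborel (indicator A)) {x \<in> space (density lborel (indicator A)). norm x \<le> a}
         = ennreal (\<kappa> * a ^ ?d)" by simp
    qed (use \<kappa>0 in \<open>auto intro!: derivative_eq_intros simp: mult_ac zero_power\<close>)
    also have "\<dots> = ennreal (\<kappa> * real ?d) * J h"
      unfolding J_def using \<kappa>0
      by (subst nn_integral_cmult[symmetric])
         (auto intro!: nn_integral_cong simp: indicator_def ennreal_mult' mult_ac)
    finally show ?thesis by (simp add: \<kappa>_def mult_ac)
  qed
  \<comment> \<open>the whole space is a cone of Gaussian measure \<open>1\<close>, which evaluates the normalising integral\<close>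
  have J1: "ennreal (omega ?d) * ennreal K * J (\<lambda>_. 1) = 1"
    using int[of UNIV "\<lambda>_. 1"]
    by (simp add: emeasure_gaussian_UNIV content_cball omega_unit_ball_vol)
  have "emeasure gaussian A = ennreal (real ?d * measure lborel (A \<inter> cball 0 1)) * ennreal K * J (\<lambda>_. 1)"
    using int[of A "\<lambda>_. 1"] A cone by simp
  moreover have "omega ?d / (2 * pi) powr (real ?d / 2) = omega ?d * K"
    by (simp add: K_def powr_minus_divide)
  then have "ennreal (omega ?d / (2 * pi) powr (real ?d / 2)) = ennreal (omega ?d) * ennreal K"
    using omega_pos[of ?d] K by (simp add: ennreal_mult)
  ultimately have "emeasure gaussian A * radial TYPE('a) h
     = (ennreal (real ?d * measure lborel (A \<inter> cball 0 1)) * ennreal K * J h) * (ennreal (omega ?d) * ennreal K * J (\<lambda>_. 1))"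
    unfolding radial_def J_def by (simp add: mult_ac)
  also have "\<dots> = (\<integral>\<^sup>+x\<in>A. h (norm x) \<partial>gaussian)"
    unfolding J1 using int[OF A h cone] by simp
  finally show ?thesis ..
qed

section \<open>Independence of radius and direction\<close>

lemma radial_cong:
  assumes "\<And>r. 0 \<le> r \<Longrightarrow> h r = h' r"
  shows "radial TYPE('a::euclidean_space) h = radial TYPE('a) h'"
  unfolding radial_def using assms
  by (intro arg_cong[where f="\<lambda>x. _ * x"] nn_integral_cong) (auto simp: indicator_def)

text \<open>
  A function \<open>u\<close> of the direction cuts a cone into smaller cones \<open>A \<inter> u -` Y\<close>, to each of which the
  radial formula applies; hence the joint law of norm and \<open>u\<close> is a product measure.
\<close>
lemma gaussian_cone_independence:
  fixes A :: "'a::euclidean_space set" and u :: "'a \<Rightarrow> real" and F :: "real \<times> real \<Rightarrow> ennreal"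
  assumes A[measurable]: "A \<in> sets borel" and cone: "\<And>c x. c > 0 \<Longrightarrow> x \<in> A \<Longrightarrow> c *\<^sub>R x \<in> A"
    and u[measurable]: "u \<in> borel_measurable borel" and u_cone: "\<And>c x. c > 0 \<Longrightarrow> u (c *\<^sub>R x) = u x"
    and F[measurable]: "F \<in> borel_measurable (borel \<Otimes>\<^sub>M borel)"
  shows "(\<integral>\<^sup>+x\<in>A. F (norm x, u x) \<partial>gaussian) = radial TYPE('a) (\<lambda>r. \<integral>\<^sup>+x\<in>A. F (r, u x) \<partial>gaussian)"
proof -
  interpret G: prob_space "gaussian :: 'a measure" by (rule prob_space_gaussian)
  define M where "M = density (gaussian :: 'a measure) (indicator A)"
  define \<nu> where "\<nu> = distr M borel u"
  define \<rho> where "\<rho> = density lborel (\<lambda>r. ennreal (omega DIM('a) / (2 * pi) powr (real DIM('a) / 2)) *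
     (ennreal (exp (- r\<^sup>2 / 2) * r ^ (DIM('a) - 1)) * indicator {0..} r))"
  have sets[measurable_cong]: "sets M = sets borel" "sets \<nu> = sets borel" "sets \<rho> = sets borel"
    by (simp_all add: M_def \<nu>_def \<rho>_def)
  have \<rho>: "(\<integral>\<^sup>+r. h r \<partial>\<rho>) = radial TYPE('a) h" if [measurable]: "h \<in> borel_measurable borel" for h
    unfolding \<rho>_def radial_def
    by (subst nn_integral_density) (auto simp: nn_integral_cmult[symmetric] mult_ac intro!: nn_integral_cong)
  have M: "(\<integral>\<^sup>+x. h x \<partial>M) = (\<integral>\<^sup>+x\<in>A. h x \<partial>gaussian)" if [measurable]: "h \<in> borel_measurable borel" for h
    unfolding M_def by (subst nn_integral_density) (auto simp: mult_ac)
  have "radial TYPE('a) (\<lambda>_. 1) = 1"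
    using gaussian_cone_radial[of "UNIV :: 'a set" "\<lambda>_. 1"] by (simp add: emeasure_gaussian_UNIV)
  then have "emeasure \<rho> (space \<rho>) = 1" using \<rho>[of "\<lambda>_. 1"] by simp
  then interpret R: prob_space \<rho> by (rule prob_spaceI)
  have "emeasure M (space M) \<le> 1"
    using M[of "\<lambda>_. 1"] G.emeasure_le_1[of A] by simp
  then have "emeasure \<nu> (space \<nu>) \<noteq> \<infinity>" unfolding \<nu>_def
    by (subst emeasure_distr) (auto simp: top_unique M_def emeasure_density)
  then interpret N: finite_measure \<nu> by (rule finite_measureI)
  have prod: "\<rho> \<Otimes>\<^sub>M \<nu> = distr M (borel \<Otimes>\<^sub>M borel) (\<lambda>x. (norm x, u x))"
  proof (rule pair_measure_eqI)
    show "sets (\<rho> \<Otimes>\<^sub>M \<nu>) = sets (distr M (borel \<Otimes>\<^sub>M borel) (\<lambda>x. (norm x, u x)))"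
      using sets by (simp cong: sets_pair_measure_cong)
    fix X Y assume "X \<in> sets \<rho>" "Y \<in> sets \<nu>"
    then have [measurable]: "X \<in> sets borel" "Y \<in> sets borel" by (simp_all add: sets)
    have [measurable]: "u -` Y \<in> sets borel" using measurable_sets_borel[OF u \<open>Y \<in> sets borel\<close>] .
    have "emeasure \<nu> Y = emeasure gaussian (A \<inter> u -` Y)"
      unfolding \<nu>_def M_def
      by (subst emeasure_distr) (auto simp: emeasure_density indicator_inter_arith[symmetric])
    moreover have "emeasure \<rho> X = radial TYPE('a) (indicator X)"
      using \<rho>[of "indicator X"] by (simp add: sets)
    moreover have "(\<integral>\<^sup>+x\<in>A \<inter> u -` Y. indicator X (norm x) \<partial>gaussian)
        = emeasure gaussian (A \<inter> u -` Y) * radial TYPE('a) (indicator X)"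
      by (rule gaussian_cone_radial) (use cone in \<open>auto simp: u_cone\<close>)
    moreover have "emeasure (distr M (borel \<Otimes>\<^sub>M borel) (\<lambda>x. (norm x, u x))) (X \<times> Y)
        = (\<integral>\<^sup>+x\<in>A \<inter> u -` Y. indicator X (norm x) \<partial>gaussian)"
    proof -
      have [measurable]: "norm -` X \<in> sets (borel :: 'a measure)"
        by (rule measurable_sets_borel[OF _ \<open>X \<in> sets borel\<close>]) measurable
      have "emeasure (distr M (borel \<Otimes>\<^sub>M borel) (\<lambda>x. (norm x, u x))) (X \<times> Y) = emeasure M (norm -` X \<inter> u -` Y)"
        by (subst emeasure_distr) (auto simp: M_def intro!: arg_cong[where f="emeasure _"])
      also have "\<dots> = (\<integral>\<^sup>+x\<in>A \<inter> u -` Y. indicator X (norm x) \<partial>gaussian)"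
        unfolding M_def by (subst emeasure_density) (auto simp: indicator_def intro!: nn_integral_cong)
      finally show ?thesis .
    qed
    ultimately show "emeasure \<rho> X * emeasure \<nu> Y = emeasure (distr M (borel \<Otimes>\<^sub>M borel) (\<lambda>x. (norm x, u x))) (X \<times> Y)"
      by (simp add: mult.commute)
  qed unfold_locales
  have "(\<integral>\<^sup>+x\<in>A. F (norm x, u x) \<partial>gaussian) = (\<integral>\<^sup>+x. F (norm x, u x) \<partial>M)"
    by (rule M[symmetric]) measurable
  also have "\<dots> = (\<integral>\<^sup>+z. F z \<partial>(\<rho> \<Otimes>\<^sub>M \<nu>))"
    unfolding prod by (rule nn_integral_distr[symmetric]) measurable
  also have "\<dots> = (\<integral>\<^sup>+r. (\<integral>\<^sup>+t. F (r, t) \<partial>\<nu>) \<partial>\<rho>)"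
    by (rule N.nn_integral_fst[symmetric]) measurable
  also have "\<dots> = radial TYPE('a) (\<lambda>r. \<integral>\<^sup>+t. F (r, t) \<partial>\<nu>)"
    by (rule \<rho>) measurable
  also have "\<dots> = radial TYPE('a) (\<lambda>r. \<integral>\<^sup>+x\<in>A. F (r, u x) \<partial>gaussian)"
  proof (rule radial_cong)
    fix r
    have "(\<integral>\<^sup>+t. F (r, t) \<partial>\<nu>) = (\<integral>\<^sup>+x. F (r, u x) \<partial>M)"
      unfolding \<nu>_def by (rule nn_integral_distr) measurable
    then show "(\<integral>\<^sup>+t. F (r, t) \<partial>\<nu>) = (\<integral>\<^sup>+x\<in>A. F (r, u x) \<partial>gaussian)"
      by (subst M[symmetric]) auto
  qed
  finally show ?thesis .
qed

section \<open>Polar coordinates by the tangent of the angle\<close>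

text \<open>
  Polar coordinates on the first quadrant, with the angle replaced by its tangent \<open>t = s / r\<close>.
  In this parametrisation the coordinate change splits into two linear substitutions, \<open>R = x * sqrt (1 + t\<^sup>2)\<close>
  for fixed \<open>t\<close> and \<open>s = x * t\<close> for fixed \<open>x\<close>, separated by an interchange of the integrals.
\<close>
lemma nn_integral_polar_tan:
  fixes F :: "real \<times> real \<Rightarrow> ennreal" and i j :: nat
  assumes F[measurable]: "F \<in> borel_measurable (borel \<Otimes>\<^sub>M borel)"
  shows "(\<integral>\<^sup>+R\<in>{0..}. (\<integral>\<^sup>+t\<in>{0..}. F (R / sqrt (1 + t\<^sup>2), R * t / sqrt (1 + t\<^sup>2)) *
            ennreal (t ^ j / sqrt (1 + t\<^sup>2) ^ (i + j + 2)) \<partial>lborel) *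
            ennreal (exp (- R\<^sup>2 / 2) * R ^ (i + j + 1)) \<partial>lborel)
       = (\<integral>\<^sup>+r\<in>{0..}. (\<integral>\<^sup>+s\<in>{0..}. F (r, s) *
            ennreal (exp (- (r\<^sup>2 + s\<^sup>2) / 2) * r ^ i * s ^ j) \<partial>lborel) \<partial>lborel)"
proof -
  define q where "q t = sqrt (1 + t\<^sup>2)" for t :: real
  have q0: "q t > 0" and q2: "(q t)\<^sup>2 = 1 + t\<^sup>2" for t
    by (auto simp: q_def add_pos_nonneg)
  have [measurable]: "q \<in> borel_measurable borel" unfolding q_def by measurable
  define E where "E R t = F (R / q t, R * t / q t) *
     (ennreal (t ^ j / q t ^ (i + j + 2)) * ennreal (exp (- R\<^sup>2 / 2) * R ^ (i + j + 1)))
      * indicator {0..} t * indicator {0..} R" for R t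
  define H where "H x t = F (x, x * t) * ennreal (exp (- (x\<^sup>2 + (x * t)\<^sup>2) / 2) * x ^ (i + j + 1) * t ^ j)
      * indicator {0..} t * indicator {0..} x" for x t
  have "(\<integral>\<^sup>+R\<in>{0..}. (\<integral>\<^sup>+t\<in>{0..}. F (R / q t, R * t / q t) *
            ennreal (t ^ j / q t ^ (i + j + 2)) \<partial>lborel) *
            ennreal (exp (- R\<^sup>2 / 2) * R ^ (i + j + 1)) \<partial>lborel)
      = (\<integral>\<^sup>+R. (\<integral>\<^sup>+t. E R t \<partial>lborel) \<partial>lborel)"
    unfolding E_def
    by (intro nn_integral_cong, subst nn_integral_multc[symmetric], measurable)
       (subst nn_integral_multc[symmetric], measurable, simp add: mult_ac)
  also have "\<dots> = (\<integral>\<^sup>+t. (\<integral>\<^sup>+R. E R t \<partial>lborel) \<partial>lborel)"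
    unfolding E_def by (rule lborel_pair.Fubini') measurable
  also have "\<dots> = (\<integral>\<^sup>+t. (\<integral>\<^sup>+x. H x t \<partial>lborel) \<partial>lborel)"
  proof (rule nn_integral_cong)
    fix t :: real
    have [measurable]: "(\<lambda>R. E R t) \<in> borel_measurable borel" unfolding E_def by measurable
    have "ennreal (q t) * E (q t * x) t = H x t" for x
    proof (cases "0 \<le> x \<and> 0 \<le> t")
      case True
      have e: "q t * (t ^ j / q t ^ (i + j + 2) * (exp (- (q t * x)\<^sup>2 / 2) * (q t * x) ^ (i + j + 1)))
          = exp (- (x\<^sup>2 + (x * t)\<^sup>2) / 2) * x ^ (i + j + 1) * t ^ j"
      proof -
        have "(q t * x)\<^sup>2 = x\<^sup>2 + (x * t)\<^sup>2" by (simp add: power_mult_distrib q2 algebra_simps)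
        then show ?thesis using q0[of t] by (simp add: power_mult_distrib field_simps)
      qed
      have "ennreal (q t) * E (q t * x) t = F (x, x * t) * ennreal (q t *
          (t ^ j / q t ^ (i + j + 2) * (exp (- (q t * x)\<^sup>2 / 2) * (q t * x) ^ (i + j + 1))))"
      proof -
        define a b where "a = t ^ j / q t ^ (i + j + 2)"
          and "b = exp (- (q t * x)\<^sup>2 / 2) * (q t * x) ^ (i + j + 1)"
        have "0 \<le> a" "0 \<le> b" using True q0[of t] by (simp_all add: a_def b_def)
        then have "ennreal (q t * (a * b)) = ennreal (q t) * (ennreal a * ennreal b)"
          using q0[of t] by (simp add: ennreal_mult')
        moreover have "E (q t * x) t = F (x, x * t) * (ennreal a * ennreal b)"
          using True q0[of t] by (simp add: E_def a_def b_def)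
        ultimately show ?thesis unfolding a_def[symmetric] b_def[symmetric] by (simp add: mult_ac)
      qed
      then show ?thesis using True unfolding e H_def by simp
    next
      case False
      then show ?thesis using q0[of t] by (auto simp: E_def H_def indicator_def zero_le_mult_iff)
    qed
    then show "(\<integral>\<^sup>+R. E R t \<partial>lborel) = (\<integral>\<^sup>+x. H x t \<partial>lborel)"
      using nn_integral_real_affine[of "\<lambda>R. E R t" "q t" 0] q0[of t]
      by (simp add: nn_integral_cmult[symmetric])
  qed
  also have "\<dots> = (\<integral>\<^sup>+x. (\<integral>\<^sup>+t. H x t \<partial>lborel) \<partial>lborel)"
    unfolding H_def by (rule lborel_pair.Fubini'[symmetric]) measurable
  also have "\<dots> = (\<integral>\<^sup>+r\<in>{0..}. (\<integral>\<^sup>+s\<in>{0..}. F (r, s) *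
            ennreal (exp (- (r\<^sup>2 + s\<^sup>2) / 2) * r ^ i * s ^ j) \<partial>lborel) \<partial>lborel)"
  proof (rule nn_integral_cong_AE)
    show "AE x in lborel. (\<integral>\<^sup>+t. H x t \<partial>lborel) = (\<integral>\<^sup>+s\<in>{0..}. F (x, s) *
            ennreal (exp (- (x\<^sup>2 + s\<^sup>2) / 2) * x ^ i * s ^ j) \<partial>lborel) * indicator {0..} x"
      \<comment> \<open>the substitution \<open>s = x * t\<close> is singular on the null set \<open>x = 0\<close>\<close>
      using AE_lborel_singleton[of 0]
    proof (rule AE_mp, intro AE_I2 impI)
      fix x :: real assume "x \<noteq> 0"
      show "(\<integral>\<^sup>+t. H x t \<partial>lborel) = (\<integral>\<^sup>+s\<in>{0..}. F (x, s) *
            ennreal (exp (- (x\<^sup>2 + s\<^sup>2) / 2) * x ^ i * s ^ j) \<partial>lborel) * indicator {0..} x"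
      proof (cases "x > 0")
        case True
        have "H x t = ennreal x * (F (x, x * t) * ennreal (exp (- (x\<^sup>2 + (x * t)\<^sup>2) / 2) * x ^ i * (x * t) ^ j)
            * indicator {0..} (x * t))" for t
        proof (cases "0 \<le> t")
          case t: True
          define c where "c = exp (- (x\<^sup>2 + (x * t)\<^sup>2) / 2) * x ^ i * (x * t) ^ j"
          have xc: "exp (- (x\<^sup>2 + (x * t)\<^sup>2) / 2) * x ^ (i + j + 1) * t ^ j = x * c"
            by (simp add: c_def power_add power_mult_distrib)
          have "H x t = F (x, x * t) * ennreal (x * c)"
            unfolding H_def xc using True t by simp
          also have "ennreal (x * c) = ennreal x * ennreal c"
            using True by (simp add: ennreal_mult')
          finally show ?thesis using True t unfolding c_def[symmetric] by (simp add: mult_ac)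
        qed (use True in \<open>simp add: H_def zero_le_mult_iff\<close>)
        then show ?thesis
          using True nn_integral_real_affine[of "\<lambda>s. F (x, s) *
            ennreal (exp (- (x\<^sup>2 + s\<^sup>2) / 2) * x ^ i * s ^ j) * indicator {0..} s" x 0]
          by (simp add: nn_integral_cmult)
      qed (use \<open>x \<noteq> 0\<close> in \<open>simp add: H_def\<close>)
    qed
  qed
  finally show ?thesis unfolding q_def .
qed

section \<open>The angular distance and the local Steiner formula\<close>

text \<open>
  The cosine of the angular distance is the quotient of \<open>norm (closest_point C x)\<close> and \<open>norm x\<close>, so
  by Pythagoras its tangent is the quotient of the norms of the two projections. The origin has
  angular distance \<open>pi / 2\<close> and satisfies neither side.
\<close>
lemma angular_dist_le_arctan_iff:
  fixes C :: "'a::euclidean_space set"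
  assumes C: "closed C" "convex_cone C" and a: "0 \<le> a"
  shows "angular_dist x C \<le> arctan a \<longleftrightarrow>
    closest_point C x \<noteq> 0 \<and> norm (closest_point (dual_cone C) x) \<le> a * norm (closest_point C x)"
proof (cases "x = 0")
  case True
  have "closest_point C 0 = 0"
    using closest_point_cone_iff[OF C, of 0 0] C by (auto simp: dual_cone_def convex_cone_iff)
  then show ?thesis using True arctan_ubound[of a] by (auto simp: angular_dist_def)
next
  case False
  define p q where "p = norm (closest_point C x)" and "q = norm (closest_point (dual_cone C) x)"
  have pq: "p \<ge> 0" "q \<ge> 0" by (auto simp: p_def q_def)
  have n: "(norm x)\<^sup>2 = p\<^sup>2 + q\<^sup>2" using norm_sq_moreau[OF C, of x] by (simp add: p_def q_def)
  have nx: "norm x > 0" using False by simp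
  have y: "0 \<le> p / norm x" "p / norm x \<le> 1"
  proof -
    have "p\<^sup>2 \<le> (norm x)\<^sup>2" using n by simp
    then show "p / norm x \<le> 1" using nx power2_le_imp_le[of p "norm x"] by (simp add: divide_le_eq)
  qed (use pq in simp)
  have "angular_dist x C \<le> arctan a \<longleftrightarrow> arccos (p / norm x) \<le> arctan a"
    using False by (simp add: angular_dist_def p_def)
  also have "\<dots> \<longleftrightarrow> cos (arctan a) \<le> cos (arccos (p / norm x))"
    using y a arctan_ubound[of a] arccos_lbound[of "p / norm x"] arccos_ubound[of "p / norm x"]
    by (intro cos_mono_le_eq[symmetric]) auto
  also have "\<dots> \<longleftrightarrow> 1 / sqrt (1 + a\<^sup>2) \<le> p / norm x"
    using y by (simp add: cos_arctan)
  also have "\<dots> \<longleftrightarrow> norm x \<le> p * sqrt (1 + a\<^sup>2)"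
    using nx by (simp add: divide_simps add_pos_nonneg mult.commute)
  also have "\<dots> \<longleftrightarrow> (norm x)\<^sup>2 \<le> (p * sqrt (1 + a\<^sup>2))\<^sup>2"
    using pq nx by (intro power_mono_iff[symmetric]) auto
  also have "\<dots> \<longleftrightarrow> q\<^sup>2 \<le> (a * p)\<^sup>2"
    by (simp add: n power_mult_distrib algebra_simps)
  also have "\<dots> \<longleftrightarrow> q \<le> a * p"
    using pq a by (intro power_mono_iff) auto
  also have "\<dots> \<longleftrightarrow> p \<noteq> 0 \<and> q \<le> a * p"
    using n nx pq by auto
  finally show ?thesis by (simp add: p_def q_def)
qed

text \<open>
  For \<open>C = {0}\<close> the formula is not part of the definition, but it holds there as well: all points
  have angular distance \<open>pi / 2\<close>, and both sides vanish.
\<close>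
lemma local_steiner_formula:
  fixes C :: "'a::euclidean_space set"
  assumes C: "closed C" "convex_cone C" and \<Omega>: "conic_support_measures C \<Omega>"
    and \<eta>: "\<eta> \<in> biconic_sets" and l: "0 \<le> l" "l < pi / 2"
  shows "measure gaussian (angular_parallel_set l C \<eta>) =
    (\<Sum>k=1..DIM('a). steiner_coeff DIM('a) k l * measure (\<Omega> k) \<eta>)"
proof (cases "C = {0}")
  case True
  have "closest_point C x = 0" for x
    using closest_point_in_set[of C x] True by auto
  then have "angular_parallel_set l C \<eta> = {}"
    using l by (auto simp: angular_parallel_set_def angular_dist_def)
  moreover have "measure (\<Omega> k) \<eta> = 0" if "k \<in> {1..DIM('a)}" for k
    using \<Omega> \<eta> that True by (auto simp: conic_support_measures_def)
  ultimately show ?thesis by simp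
next
  case False
  then show ?thesis using \<Omega> \<eta> l by (auto simp: conic_support_measures_def)
qed

text \<open>
  The substitution \<open>t = tan \<phi>\<close> in the Steiner coefficients, done by differentiation.
\<close>
lemma sin_cos_integral_arctan:
  fixes i j :: nat
  obtains G where "\<And>t. (G has_real_derivative t ^ j / sqrt (1 + t\<^sup>2) ^ (i + j + 2)) (at t)"
    "\<And>a. 0 \<le> a \<Longrightarrow> G a = integral {0..arctan a} (\<lambda>\<phi>. cos \<phi> ^ i * sin \<phi> ^ j)"
proof -
  define w :: "real \<Rightarrow> real" where "w \<phi> = cos \<phi> ^ i * sin \<phi> ^ j" for \<phi>
  \<comment> \<open>the base point \<open>-2\<close> lies below the range of \<open>arctan\<close>, so \<open>G\<close> is also differentiable at \<open>0\<close>\<close>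
  define G where "G a = integral {-2..arctan a} w - integral {-2..0} w" for a
  have cont: "continuous_on S w" for S unfolding w_def by (intro continuous_intros)
  have "(G has_real_derivative t ^ j / sqrt (1 + t\<^sup>2) ^ (i + j + 2)) (at t)" for t
  proof -
    have b: "-2 < arctan t" "arctan t < 2"
      using arctan_lbound[of t] arctan_ubound[of t] pi_half_less_two by linarith+
    have "((\<lambda>x. integral {-2..x} w) has_real_derivative w (arctan t)) (at (arctan t) within {-2..2})"
      using b by (intro integral_has_real_derivative cont) auto
    moreover have "at (arctan t) within {-2..2} = at (arctan t)"
      using b by (intro at_within_interior) auto
    ultimately have "((\<lambda>x. integral {-2..x} w) has_real_derivative w (arctan t)) (at (arctan t))" by simp
    from DERIV_chain2[OF this DERIV_arctan]
    have "(G has_real_derivative w (arctan t) * inverse (1 + t\<^sup>2)) (at t)"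
      unfolding G_def by (auto intro!: derivative_eq_intros)
    moreover have "w (arctan t) * inverse (1 + t\<^sup>2) = t ^ j / sqrt (1 + t\<^sup>2) ^ (i + j + 2)"
      by (simp add: w_def cos_arctan sin_arctan power_add power_divide divide_simps add_nonneg_eq_0_iff)
    ultimately show ?thesis by simp
  qed
  moreover have "G a = integral {0..arctan a} w" if "0 \<le> a" for a
    unfolding G_def using that Henstock_Kurzweil_Integration.integral_combine[of "-2" 0 "arctan a" w]
    by (simp add: integrable_continuous_real[OF cont])
  ultimately show ?thesis using that unfolding w_def by blast
qed

section \<open>Rotation invariance of Lebesgue measure\<close>

text \<open>
  Uniqueness of Haar measure, by the usual Fubini argument: the measure of
  \<open>{(x, y). x \<in> B \<and> x + y \<in> A}\<close> under \<open>lborel \<Otimes>\<^sub>M \<mu>\<close> is computed in both orders, using the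
  invariance of \<open>\<mu>\<close> in one order and that of both measures in the other. The unit ball serves as
  \<open>B\<close> because it is symmetric and has positive finite measure.
\<close>
lemma lborel_eqI_translation_invariant:
  fixes \<mu> :: "'a::euclidean_space measure"
  assumes sets[measurable_cong]: "sets \<mu> = sets borel" and sf: "sigma_finite_measure \<mu>"
    and inv: "\<And>c. distr \<mu> borel ((+) c) = \<mu>"
    and ball: "emeasure \<mu> (cball 0 1) = emeasure lborel (cball (0::'a) 1)"
  shows "\<mu> = lborel"
proof (rule measure_eqI)
  interpret M: sigma_finite_measure \<mu> by fact
  interpret pair_sigma_finite \<mu> "lborel :: 'a measure" by standard
  let ?B = "cball (0::'a) 1"
  have [measurable]: "?B \<in> sets borel" by simp
  have B: "emeasure lborel ?B \<noteq> 0" "emeasure lborel ?B \<noteq> top"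
    using unit_ball_vol_pos[of "real DIM('a)"] by (simp_all add: emeasure_cball del: unit_ball_vol_pos)
  fix A :: "'a set" assume "A \<in> sets \<mu>"
  then have A[measurable]: "A \<in> sets borel" by (simp add: sets)
  have transl: "(\<integral>\<^sup>+y. f y \<partial>\<nu>) = (\<integral>\<^sup>+y. f (c + y) \<partial>\<nu>)"
    if "distr \<nu> borel ((+) c) = \<nu>" "sets \<nu> = sets borel" and [measurable]: "f \<in> borel_measurable borel"
    for \<nu> :: "'a measure" and f c
  proof -
    note that(2)[measurable_cong]
    have "(\<integral>\<^sup>+y. f y \<partial>\<nu>) = (\<integral>\<^sup>+y. f y \<partial>distr \<nu> borel ((+) c))" by (simp only: that(1))
    also have "\<dots> = (\<integral>\<^sup>+y. f (c + y) \<partial>\<nu>)" by (intro nn_integral_distr) measurable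
    finally show ?thesis .
  qed
  have "emeasure lborel ?B * emeasure \<mu> A
      = (\<integral>\<^sup>+x. indicator ?B x * (\<integral>\<^sup>+y. indicator A y \<partial>\<mu>) \<partial>lborel)"
  proof -
    have "(\<integral>\<^sup>+x. indicator ?B x * emeasure \<mu> A \<partial>lborel) = (\<integral>\<^sup>+x. indicator ?B x \<partial>lborel) * emeasure \<mu> A"
      by (rule nn_integral_multc) measurable
    then show ?thesis by (simp add: sets)
  qed
  also have "\<dots> = (\<integral>\<^sup>+x. (\<integral>\<^sup>+y. indicator ?B x * indicator A (x + y) \<partial>\<mu>) \<partial>lborel)"
  proof (rule nn_integral_cong)
    fix x
    have "(\<integral>\<^sup>+y. indicator ?B x * indicator A (x + y) \<partial>\<mu>)
       = indicator ?B x * (\<integral>\<^sup>+y. indicator A (x + y) \<partial>\<mu>)"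
      by (rule nn_integral_cmult) measurable
    then show "indicator ?B x * (\<integral>\<^sup>+y. indicator A y \<partial>\<mu>)
       = (\<integral>\<^sup>+y. indicator ?B x * indicator A (x + y) \<partial>\<mu>)"
      using transl[OF inv sets, of "indicator A" x] by simp
  qed
  also have "\<dots> = (\<integral>\<^sup>+y. (\<integral>\<^sup>+x. indicator ?B x * indicator A (x + y) \<partial>lborel) \<partial>\<mu>)"
    by (rule Fubini') measurable
  also have "\<dots> = (\<integral>\<^sup>+y. (\<integral>\<^sup>+x. indicator ?B (- y + x) * indicator A x \<partial>lborel) \<partial>\<mu>)"
  proof (rule nn_integral_cong)
    fix y
    show "(\<integral>\<^sup>+x. indicator ?B x * indicator A (x + y) \<partial>lborel)
       = (\<integral>\<^sup>+x. indicator ?B (- y + x) * indicator A x \<partial>lborel)"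
      using transl[OF lborel_distr_plus, of "\<lambda>x. indicator ?B x * indicator A (x + y)" "- y"] by simp
  qed
  also have "\<dots> = (\<integral>\<^sup>+x. (\<integral>\<^sup>+y. indicator ?B (- y + x) * indicator A x \<partial>\<mu>) \<partial>lborel)"
    by (rule Fubini'[symmetric]) measurable
  also have "\<dots> = (\<integral>\<^sup>+x. emeasure \<mu> ?B * indicator A x \<partial>lborel)"
  proof (rule nn_integral_cong)
    fix x
    have "(\<integral>\<^sup>+y. indicator ?B (- y + x) * indicator A x \<partial>\<mu>)
       = (\<integral>\<^sup>+y. indicator ?B (- y + x) \<partial>\<mu>) * indicator A x"
      by (rule nn_integral_multc) measurable
    also have "(\<integral>\<^sup>+y. indicator ?B (- y + x) \<partial>\<mu>) = (\<integral>\<^sup>+y. indicator ?B (- (x + y) + x) \<partial>\<mu>)"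
      by (rule transl[OF inv sets]) measurable
    also have "\<dots> = (\<integral>\<^sup>+y. indicator ?B y \<partial>\<mu>)" by (simp add: indicator_def)
    also have "\<dots> = emeasure \<mu> ?B" by (simp add: sets)
    finally show "(\<integral>\<^sup>+y. indicator ?B (- y + x) * indicator A x \<partial>\<mu>) = emeasure \<mu> ?B * indicator A x" .
  qed
  also have "\<dots> = emeasure lborel ?B * emeasure lborel A"
    by (simp add: nn_integral_cmult ball)
  finally show "emeasure \<mu> A = emeasure lborel A"
    using B by (simp add: ennreal_mult_cancel_left)
qed (simp add: assms)

text \<open>
  The image under an orthogonal map is again translation invariant, and the unit ball is its own
  preimage.
\<close>
lemma lborel_distr_orthogonal:
  fixes T :: "'a::euclidean_space \<Rightarrow> 'a"
  assumes T: "orthogonal_transformation T"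
  shows "distr lborel borel T = lborel"
proof (rule lborel_eqI_translation_invariant)
  have lin: "linear T" using T by (rule orthogonal_transformation_linear)
  have [measurable]: "T \<in> borel_measurable borel"
    using linear_continuous_on[of T] lin by (auto intro: borel_measurable_continuous_onI simp: linear_conv_bounded_linear)
  have vim: "T -` cball 0 r = cball 0 r" for r
    using orthogonal_transformation_norm[OF T] by auto
  show "sets (distr lborel borel T) = sets borel" by simp
  show "emeasure (distr lborel borel T) (cball 0 1) = emeasure lborel (cball (0::'a) 1)"
    by (simp add: emeasure_distr vim)
  show "sigma_finite_measure (distr lborel borel T)"
  proof
    show "\<exists>A. countable A \<and> A \<subseteq> sets (distr lborel borel T) \<and> \<Union> A = space (distr lborel borel T) \<and>
       (\<forall>a\<in>A. emeasure (distr lborel borel T) a \<noteq> \<infinity>)"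
    proof (intro exI[of _ "range (\<lambda>n::nat. cball (0::'a) (real n))"] conjI ballI)
      show "\<Union> (range (\<lambda>n::nat. cball (0::'a) (real n))) = space (distr lborel borel T)"
        by (auto intro: real_arch_simple)
    qed (auto simp: emeasure_distr vim emeasure_cball)
  qed
  show "distr (distr lborel borel T) borel ((+) c) = distr lborel borel T" for c
  proof -
    obtain b where b: "T b = c" using orthogonal_transformation_surj[OF T] by (metis surjD)
    have "distr (distr lborel borel T) borel ((+) c) = distr lborel borel (\<lambda>x. T (b + x))"
      using lin b by (simp add: distr_distr comp_def linear_add)
    also have "\<dots> = distr (distr lborel borel ((+) b)) borel T"
      by (simp add: distr_distr comp_def)
    finally show ?thesis by (simp add: lborel_distr_plus)
  qed
qed

text \<open>
  Orthonormal bases of \<open>L\<close> and of its orthogonal complement together have as many elements as the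
  standard basis, so matching them with it gives the rotation.
\<close>
lemma orthogonal_transformation_adapted_to_subspace:
  fixes L :: "'a::euclidean_space set"
  assumes L: "subspace L"
  obtains T :: "'a \<Rightarrow> 'a" and S where "orthogonal_transformation T" "S \<subseteq> Basis" "card S = dim L"
    "\<And>b. b \<in> S \<Longrightarrow> T b \<in> L" "\<And>b y. b \<in> Basis - S \<Longrightarrow> y \<in> L \<Longrightarrow> T b \<bullet> y = 0"
proof -
  define L' where "L' = {y. \<forall>x\<in>L. orthogonal x y}"
  have L': "subspace L'" by (simp add: L'_def subspace_orthogonal_to_vectors)
  have dims: "dim L' + dim L = DIM('a)"
    using dim_subspace_orthogonal_to_vectors[OF L subspace_UNIV] by (simp add: L'_def dim_UNIV)
  obtain B where B: "B \<subseteq> L" "pairwise orthogonal B" "\<And>x. x \<in> B \<Longrightarrow> norm x = 1"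
    "independent B" "card B = dim L"
    using orthonormal_basis_subspace[OF L] by metis
  obtain B' where B': "B' \<subseteq> L'" "pairwise orthogonal B'" "\<And>x. x \<in> B' \<Longrightarrow> norm x = 1"
    "independent B'" "card B' = dim L'"
    using orthonormal_basis_subspace[OF L'] by metis
  have fin: "finite B" "finite B'" using B B' independent_imp_finite by blast+
  have "dim L \<le> card (Basis::'a set)" by (rule dim_subset_UNIV)
  then obtain S where S: "S \<subseteq> (Basis::'a set)" "card S = dim L" and finS: "finite S"
    by (rule obtain_subset_with_card_n)
  have "card (Basis - S) = dim L'"
    using S dims by (simp add: card_Diff_subset finS)
  then obtain p q where p: "bij_betw p S B" and q: "bij_betw q (Basis - S) B'"
    using finite_same_card_bij[of S B] finite_same_card_bij[of "Basis - S" B'] fin finS S B(5) B'(5)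
    by auto
  define \<pi> where "\<pi> b = (if b \<in> S then p b else q b)" for b
  have \<pi>L: "\<pi> b \<in> B" if "b \<in> S" for b using that p by (auto simp: \<pi>_def bij_betw_def)
  have \<pi>L': "\<pi> b \<in> B'" if "b \<in> Basis - S" for b using that q by (auto simp: \<pi>_def bij_betw_def)
  have orthLL': "x \<bullet> y = 0" if "x \<in> L" "y \<in> L'" for x y
    using that by (auto simp: L'_def orthogonal_def)
  have on: "\<pi> b \<bullet> \<pi> c = (if b = c then 1 else 0)" if b: "b \<in> Basis" and c: "c \<in> Basis" for b c
  proof (cases "b = c")
    case True
    then have "norm (\<pi> b) = 1" using b \<pi>L \<pi>L' B(3) B'(3) by (cases "b \<in> S") auto
    then show ?thesis using True by (simp add: norm_eq_1)
  next
    case False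
    have inj: "inj_on p S" "inj_on q (Basis - S)" using p q by (auto simp: bij_betw_def)
    consider "b \<in> S" "c \<in> S" | "b \<in> S" "c \<notin> S" | "b \<notin> S" "c \<in> S" | "b \<notin> S" "c \<notin> S" by auto
    then have "\<pi> b \<bullet> \<pi> c = 0"
    proof cases
      case 1
      then have "\<pi> b \<noteq> \<pi> c" using False inj by (auto simp: \<pi>_def inj_on_def)
      then show ?thesis using 1 \<pi>L B(2) by (auto simp: pairwise_def orthogonal_def)
    next
      case 2
      then show ?thesis using \<pi>L[of b] \<pi>L'[of c] c B(1) B'(1) orthLL' by auto
    next
      case 3
      then show ?thesis using \<pi>L[of c] \<pi>L'[of b] b B(1) B'(1) orthLL' by (metis DiffI inner_commute subsetD)
    next
      case 4
      then have "\<pi> b \<noteq> \<pi> c" using False inj b c by (auto simp: \<pi>_def inj_on_def)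
      then show ?thesis using 4 b c \<pi>L' B'(2) by (auto simp: pairwise_def orthogonal_def)
    qed
    then show ?thesis using False by simp
  qed
  define T where "T x = (\<Sum>b\<in>Basis. (x \<bullet> b) *\<^sub>R \<pi> b)" for x :: 'a
  have Tb: "T b = \<pi> b" if "b \<in> Basis" for b
  proof -
    have "T b = (\<Sum>c\<in>Basis. if b = c then \<pi> b else 0)"
      unfolding T_def using that by (intro sum.cong refl) (auto simp: inner_Basis)
    then show ?thesis using that by simp
  qed
  have "T x \<bullet> T y = x \<bullet> y" for x y
  proof -
    have "T x \<bullet> T y = (\<Sum>b\<in>Basis. \<Sum>c\<in>Basis. (x \<bullet> b) * ((y \<bullet> c) * (\<pi> b \<bullet> \<pi> c)))"
      unfolding T_def inner_sum_left unfolding inner_sum_right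
      by (intro sum.cong refl) (simp add: mult_ac)
    also have "\<dots> = (\<Sum>b\<in>Basis. (x \<bullet> b) * (y \<bullet> b))"
    proof (intro sum.cong refl)
      fix b :: 'a assume b: "b \<in> Basis"
      have "(\<Sum>c\<in>Basis. (x \<bullet> b) * ((y \<bullet> c) * (\<pi> b \<bullet> \<pi> c)))
          = (\<Sum>c\<in>Basis. if b = c then (x \<bullet> b) * (y \<bullet> b) else 0)"
        using b by (intro sum.cong refl) (simp add: on)
      then show "(\<Sum>c\<in>Basis. (x \<bullet> b) * ((y \<bullet> c) * (\<pi> b \<bullet> \<pi> c))) = (x \<bullet> b) * (y \<bullet> b)"
        using b by simp
    qed
    also have "\<dots> = x \<bullet> y" by (rule euclidean_inner[of x y, symmetric])
    finally show ?thesis .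
  qed
  moreover have "linear T"
    unfolding T_def by (intro linear_compose_sum ballI linearI) (simp_all add: inner_add_left scaleR_add_left)
  ultimately have "orthogonal_transformation T" by (simp add: orthogonal_transformation_def)
  moreover have "T b \<in> L" if "b \<in> S" for b
    using that S(1) \<pi>L[OF that] B(1) Tb[of b] by (metis subsetD)
  moreover have "T b \<bullet> y = 0" if "b \<in> Basis - S" "y \<in> L" for b y
  proof -
    have "T b \<in> L'" using that \<pi>L'[OF that(1)] B'(1) Tb[of b] by (metis DiffD1 subsetD)
    then show ?thesis using orthLL'[OF that(2), of "T b"] inner_commute[of y "T b"] by simp
  qed
  ultimately show ?thesis by (rule that[OF _ S])
qed

lemma closest_point_subspace_rotated:
  fixes L :: "'a::euclidean_space set" and T :: "'a \<Rightarrow> 'a"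
  assumes L: "subspace L" and T: "orthogonal_transformation T" and S: "S \<subseteq> Basis"
    and TL: "\<And>b. b \<in> S \<Longrightarrow> T b \<in> L" and TL': "\<And>b y. b \<in> Basis - S \<Longrightarrow> y \<in> L \<Longrightarrow> T b \<bullet> y = 0"
  shows "norm (closest_point L (T x)) = sqrt (\<Sum>b\<in>S. (x \<bullet> b)\<^sup>2)"
    and "norm (closest_point (dual_cone L) (T x)) = sqrt (\<Sum>b\<in>Basis - S. (x \<bullet> b)\<^sup>2)"
proof -
  have lin: "linear T" using T by (rule orthogonal_transformation_linear)
  define u :: "'a set \<Rightarrow> 'a" where "u I = (\<Sum>b\<in>I. (x \<bullet> b) *\<^sub>R b)" for I
  have Tu: "T (u I) = (\<Sum>b\<in>I. (x \<bullet> b) *\<^sub>R T b)" for I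
    unfolding u_def linear_sum[OF lin] linear_scale[OF lin] ..
  have "u Basis = x" by (simp add: u_def euclidean_representation)
  moreover have "u Basis = u S + u (Basis - S)"
    unfolding u_def using sum.subset_diff[OF S finite_Basis, of "\<lambda>b. (x \<bullet> b) *\<^sub>R b"]
    by (simp only: add.commute)
  ultimately have "x = u S + u (Basis - S)" by (simp only:)
  then have x: "T x = T (u S) + T (u (Basis - S))"
    using linear_add[OF lin] by (simp only:)
  have norm: "norm (T (u I)) = sqrt (\<Sum>b\<in>I. (x \<bullet> b)\<^sup>2)" if I: "I \<subseteq> Basis" for I
  proof -
    have finI: "finite I" using finite_subset[OF I finite_Basis] .
    have "u I \<bullet> u I = (\<Sum>b\<in>I. \<Sum>c\<in>I. (x \<bullet> b) * ((x \<bullet> c) * (b \<bullet> c)))"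
      unfolding u_def inner_sum_left unfolding inner_sum_right
      by (intro sum.cong refl) (simp add: mult_ac inner_commute)
    also have "\<dots> = (\<Sum>b\<in>I. (x \<bullet> b)\<^sup>2)"
    proof (intro sum.cong refl)
      fix b assume b: "b \<in> I"
      have "(\<Sum>c\<in>I. (x \<bullet> b) * ((x \<bullet> c) * (b \<bullet> c))) = (\<Sum>c\<in>I. if b = c then (x \<bullet> b)\<^sup>2 else 0)"
        using b by (intro sum.cong) (auto simp: inner_Basis subsetD[OF I] power2_eq_square)
      then show "(\<Sum>c\<in>I. (x \<bullet> b) * ((x \<bullet> c) * (b \<bullet> c))) = (x \<bullet> b)\<^sup>2"
        using finI b by simp
    qed
    finally show ?thesis
      using orthogonal_transformation_norm[OF T] by (simp add: norm_eq_sqrt_inner)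
  qed
  have cc: "closed L" "convex_cone L"
    using L by (auto simp: closed_subspace convex_cone_iff subspace_def)
  have in_L: "T (u S) \<in> L" unfolding Tu using L TL by (intro subspace_sum subspace_scale) auto
  have perp: "T (u (Basis - S)) \<bullet> y = 0" if "y \<in> L" for y
    unfolding Tu using TL' that by (simp add: inner_sum_left)
  have P: "closest_point L (T x) = T (u S)"
    using closest_point_cone_iff[OF cc, of "T x" "T (u S)"] in_L perp
    by (auto simp: x dual_cone_def)
  show "norm (closest_point L (T x)) = sqrt (\<Sum>b\<in>S. (x \<bullet> b)\<^sup>2)"
    using norm[OF S] P by simp
  show "norm (closest_point (dual_cone L) (T x)) = sqrt (\<Sum>b\<in>Basis - S. (x \<bullet> b)\<^sup>2)"
    using norm[of "Basis - S"] moreau_decomposition[OF cc, of "T x"] P by (simp add: x)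
qed

section \<open>Gaussian integrals of the two distances to a linear subspace\<close>

text \<open>
  The law of the Euclidean norm in \<open>card I\<close> coordinates; its distribution function is the volume of
  a ball.
\<close>
lemma nn_integral_PiM_l2_norm:
  fixes h :: "real \<Rightarrow> ennreal" and I :: "'i set"
  assumes I: "finite I" "I \<noteq> {}" and h: "h \<in> borel_measurable borel"
  shows "(\<integral>\<^sup>+f. h (sqrt (\<Sum>i\<in>I. (f i)\<^sup>2)) \<partial>(\<Pi>\<^sub>M i\<in>I. lborel))
    = (\<integral>\<^sup>+r\<in>{0..}. h r * ennreal (omega (card I) * r ^ (card I - 1)) \<partial>lborel)"
proof (rule nn_integral_distribution_function[where G="\<lambda>r. unit_ball_vol (card I) * r ^ card I"])
  let ?M = "\<Pi>\<^sub>M i\<in>I. lborel :: real measure"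
  interpret product_sigma_finite "\<lambda>_::'i. lborel :: real measure" by standard
  have card: "card I > 0" using I by (simp add: card_gt_0_iff)
  show "(\<lambda>f. sqrt (\<Sum>i\<in>I. (f i)\<^sup>2)) \<in> borel_measurable ?M" by measurable
  show "(\<lambda>r. omega (card I) * r ^ (card I - 1)) \<in> borel_measurable borel" by measurable
  show "((\<lambda>r. unit_ball_vol (card I) * r ^ card I) has_real_derivative omega (card I) * r ^ (card I - 1)) (at r)" for r
    using card by (auto intro!: derivative_eq_intros simp: omega_unit_ball_vol)
  show "emeasure ?M {f \<in> space ?M. sqrt (\<Sum>i\<in>I. (f i)\<^sup>2) \<le> a} = ennreal (unit_ball_vol (card I) * a ^ card I)"
    if "0 \<le> a" for a
  proof (cases "a = 0")
    case True
    have null: "{f \<in> space ?M. sqrt (\<Sum>i\<in>I. (f i)\<^sup>2) \<le> a} = Pi\<^sub>E I (\<lambda>_. {0})"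
    proof -
      have "sqrt (\<Sum>i\<in>I. (f i)\<^sup>2) \<le> 0 \<longleftrightarrow> (\<forall>i\<in>I. f i = 0)" for f :: "'i \<Rightarrow> real"
      proof -
        have "sqrt (\<Sum>i\<in>I. (f i)\<^sup>2) \<le> 0 \<longleftrightarrow> (\<Sum>i\<in>I. (f i)\<^sup>2) = 0"
          using sum_nonneg[of I "\<lambda>i. (f i)\<^sup>2"] by (auto simp: order.antisym)
        then show ?thesis using I by (simp add: sum_nonneg_eq_0_iff)
      qed
      then show ?thesis unfolding True by (auto simp: space_PiM PiE_iff extensional_def restrict_def)
    qed
    have "emeasure ?M (Pi\<^sub>E I (\<lambda>_. {0})) = 0"
      by (subst emeasure_PiM) (use I card in auto)
    then show ?thesis unfolding null using True card by simp
  next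
    case False
    have "{f \<in> space ?M. sqrt (\<Sum>i\<in>I. (f i)\<^sup>2) \<le> a} = {f. sqrt (\<Sum>i\<in>I. (f i)\<^sup>2) \<le> a} \<inter> space ?M" by auto
    then show ?thesis using emeasure_cball_aux[OF I(1), of a] False that by simp
  qed
  show "0 \<le> omega (card I) * r ^ (card I - 1)" if "0 \<le> r" for r
    using omega_pos[OF card] that by simp
  show "0 \<le> sqrt (\<Sum>i\<in>I. (f i)\<^sup>2)" for f :: "'i \<Rightarrow> real" by (simp add: sum_nonneg)
  show "unit_ball_vol (card I) * 0 ^ card I = 0" using card by simp
qed (rule h)

text \<open>
  After a rotation, \<open>L\<close> is spanned by some of the standard basis vectors. The two norms then depend
  on complementary groups of coordinates, and Lebesgue measure is a product over these.
\<close>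
lemma nn_integral_lborel_subspace:
  fixes L :: "'a::euclidean_space set" and F :: "real \<times> real \<Rightarrow> ennreal"
  assumes L: "subspace L" and k: "0 < dim L" "dim L < DIM('a)"
    and F[measurable]: "F \<in> borel_measurable (borel \<Otimes>\<^sub>M borel)"
  shows "(\<integral>\<^sup>+x. F (norm (closest_point L x), norm (closest_point (dual_cone L) x)) \<partial>lborel)
    = (\<integral>\<^sup>+r\<in>{0..}. (\<integral>\<^sup>+s\<in>{0..}. F (r, s) *
         ennreal (omega (DIM('a) - dim L) * s ^ (DIM('a) - dim L - 1)) \<partial>lborel) *
         ennreal (omega (dim L) * r ^ (dim L - 1)) \<partial>lborel)"
proof -
  obtain T :: "'a \<Rightarrow> 'a" and S where T: "orthogonal_transformation T" and S: "S \<subseteq> Basis" "card S = dim L"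
    and TS: "\<And>b. b \<in> S \<Longrightarrow> T b \<in> L" "\<And>b y. b \<in> Basis - S \<Longrightarrow> y \<in> L \<Longrightarrow> T b \<bullet> y = 0"
    using orthogonal_transformation_adapted_to_subspace[OF L] by metis
  note PQ = closest_point_subspace_rotated[OF L T S(1) TS]
  let ?S' = "Basis - S"
  interpret product_sigma_finite "\<lambda>_::'a. lborel :: real measure" by standard
  have fin: "finite S" "finite ?S'" using finite_subset[OF S(1) finite_Basis] by auto
  have cS': "card ?S' = DIM('a) - dim L" using S fin by (simp add: card_Diff_subset)
  have ne: "S \<noteq> {}" "?S' \<noteq> {}" using k S cS' by (auto simp del: Diff_eq_empty_iff)
  have un: "S \<union> ?S' = Basis" "S \<inter> ?S' = {}" using S by auto
  have cc: "closed L" "convex_cone L"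
    using L by (auto simp: closed_subspace convex_cone_iff subspace_def)
  have [measurable]: "closest_point L \<in> borel_measurable borel" "closest_point (dual_cone L) \<in> borel_measurable borel"
    using closest_point_measurable cc dual_cone_closed dual_cone_convex_cone by blast+
  have [measurable]: "T \<in> borel_measurable borel"
    using linear_continuous_on[of T] orthogonal_transformation_linear[OF T]
    by (auto intro: borel_measurable_continuous_onI simp: linear_conv_bounded_linear)
  let ?N = "\<lambda>I f. sqrt (\<Sum>b\<in>I. (f b)\<^sup>2) :: real"
  have "(\<integral>\<^sup>+x. F (norm (closest_point L x), norm (closest_point (dual_cone L) x)) \<partial>lborel)
     = (\<integral>\<^sup>+x. F (norm (closest_point L x), norm (closest_point (dual_cone L) x)) \<partial>distr lborel borel T)"
    by (simp only: lborel_distr_orthogonal[OF T])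
  also have "\<dots> = (\<integral>\<^sup>+x. F (norm (closest_point L (T x)), norm (closest_point (dual_cone L) (T x))) \<partial>lborel)"
    by (rule nn_integral_distr) measurable
  also have "\<dots> = (\<integral>\<^sup>+x. F (?N S (\<lambda>b. x \<bullet> b), ?N ?S' (\<lambda>b. x \<bullet> b)) \<partial>lborel)"
    by (simp only: PQ)
  also have "\<dots> = (\<integral>\<^sup>+f. F (?N S (\<lambda>b. (\<Sum>c\<in>Basis. f c *\<^sub>R c) \<bullet> b), ?N ?S' (\<lambda>b. (\<Sum>c\<in>Basis. f c *\<^sub>R c) \<bullet> b))
      \<partial>(\<Pi>\<^sub>M b\<in>Basis. lborel))"
    by (subst lborel_eq, rule nn_integral_distr) measurable
  also have "\<dots> = (\<integral>\<^sup>+f. F (?N S f, ?N ?S' f) \<partial>(\<Pi>\<^sub>M b\<in>S \<union> ?S'. lborel))"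
    unfolding un
    by (intro nn_integral_cong arg_cong[where f=F] arg_cong2[where f=Pair] arg_cong[where f=sqrt] sum.cong)
       (use S in \<open>auto simp: subsetD\<close>)
  also have "\<dots> = (\<integral>\<^sup>+f. (\<integral>\<^sup>+g. F (?N S (merge S ?S' (f, g)), ?N ?S' (merge S ?S' (f, g)))
      \<partial>(\<Pi>\<^sub>M b\<in>?S'. lborel)) \<partial>(\<Pi>\<^sub>M b\<in>S. lborel))"
    by (rule product_nn_integral_fold) (use fin in \<open>auto intro!: measurable_compose[OF _ F] simp: un\<close>)
  also have "\<dots> = (\<integral>\<^sup>+f. (\<integral>\<^sup>+g. F (?N S f, ?N ?S' g)
      \<partial>(\<Pi>\<^sub>M b\<in>?S'. lborel)) \<partial>(\<Pi>\<^sub>M b\<in>S. lborel))"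
    by (simp add: merge_def cong: sum.cong_simp)
  also have "\<dots> = (\<integral>\<^sup>+f. (\<integral>\<^sup>+s\<in>{0..}. F (?N S f, s) *
         ennreal (omega (DIM('a) - dim L) * s ^ (DIM('a) - dim L - 1)) \<partial>lborel) \<partial>(\<Pi>\<^sub>M b\<in>S. lborel))"
    by (subst nn_integral_PiM_l2_norm[OF fin(2) ne(2)]) (simp_all add: cS')
  also have "\<dots> = (\<integral>\<^sup>+r\<in>{0..}. (\<integral>\<^sup>+s\<in>{0..}. F (r, s) *
         ennreal (omega (DIM('a) - dim L) * s ^ (DIM('a) - dim L - 1)) \<partial>lborel) *
         ennreal (omega (dim L) * r ^ (dim L - 1)) \<partial>lborel)"
    unfolding S(2)[symmetric]
    by (rule nn_integral_PiM_l2_norm[OF fin(1) ne(1)]) measurable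
  finally show ?thesis .
qed

section \<open>Decomposition of the Gaussian integral over a cone\<close>

text \<open>
  The functional of the theorem for an integrand that depends on the norms instead of their
  squares and is already extended-real valued. Such an integrand can be taken measurable on the
  whole plane, so no side conditions on its domain have to be carried along.
\<close>
definition projection_integral :: "(real \<times> real \<Rightarrow> ennreal) \<Rightarrow> 'a::euclidean_space set \<Rightarrow> ('a \<times> 'a) set \<Rightarrow> ennreal" where
  "projection_integral F C \<eta> = (\<integral>\<^sup>+x. F (norm (closest_point C x), norm (closest_point (dual_cone C) x)) *
    indicator \<eta> (closest_point C x, closest_point (dual_cone C) x) \<partial>gaussian)"

text \<open>
  The expectation of \<open>F (norm x, norm y)\<close> for independent standard Gaussian vectors \<open>x\<close> and \<open>y\<close> of
  dimensions \<open>k\<close> and \<open>d - k\<close>, for \<open>0 < k < d\<close>.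
\<close>
definition biradial :: "nat \<Rightarrow> nat \<Rightarrow> (real \<times> real \<Rightarrow> ennreal) \<Rightarrow> ennreal" where
  "biradial d k F = ennreal (omega k * omega (d - k) / (2 * pi) powr (real d / 2)) *
     (\<integral>\<^sup>+r\<in>{0..}. (\<integral>\<^sup>+s\<in>{0..}. F (r, s) *
        ennreal (exp (- (r\<^sup>2 + s\<^sup>2) / 2) * r ^ (k - 1) * s ^ (d - k - 1)) \<partial>lborel) \<partial>lborel)"

text \<open>
  Integrating \<open>F\<close> against the chi law of the radius and the \<open>k\<close>-th Steiner density of the tangent
  gives the explicit double integral; this is where the constants of the theorem come from.
\<close>
lemma biradial_polar:
  fixes F :: "real \<times> real \<Rightarrow> ennreal"
  assumes F[measurable]: "F \<in> borel_measurable (borel \<Otimes>\<^sub>M borel)" and k: "1 \<le> k" "k < DIM('a::euclidean_space)"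
  shows "ennreal (omega k * omega (DIM('a) - k) / omega DIM('a)) *
      radial TYPE('a) (\<lambda>R. \<integral>\<^sup>+t\<in>{0..}. F (R / sqrt (1 + t\<^sup>2), R * t / sqrt (1 + t\<^sup>2)) *
        ennreal (t ^ (DIM('a) - k - 1) / sqrt (1 + t\<^sup>2) ^ DIM('a)) \<partial>lborel)
    = biradial DIM('a) k F"
proof -
  let ?d = "DIM('a)"
  have e: "k - 1 + (?d - k - 1) + 2 = ?d" "k - 1 + (?d - k - 1) + 1 = ?d - 1" using k by auto
  have "omega ?d > 0" "omega k > 0" "omega (?d - k) > 0" using k by (auto intro: omega_pos)
  then have "ennreal (omega k * omega (?d - k) / omega ?d) * ennreal (omega ?d / (2 * pi) powr (real ?d / 2))
      = ennreal (omega k * omega (?d - k) / (2 * pi) powr (real ?d / 2))"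
    by (subst ennreal_mult'[symmetric]) auto
  then show ?thesis
    unfolding radial_def biradial_def
    using nn_integral_polar_tan[OF F, of "?d - k - 1" "k - 1", unfolded e]
    by (simp only: mult.assoc[symmetric])
qed

lemma radial_cmult_sum:
  assumes "finite K" and [measurable]: "\<And>k. k \<in> K \<Longrightarrow> h k \<in> borel_measurable borel"
  shows "radial TYPE('a::euclidean_space) (\<lambda>r. \<Sum>k\<in>K. c k * h k r) = (\<Sum>k\<in>K. c k * radial TYPE('a) (h k))"
proof -
  let ?v = "\<lambda>r. ennreal (exp (- r\<^sup>2 / 2) * r ^ (DIM('a) - 1)) * indicator {0..} r"
  have "(\<integral>\<^sup>+r\<in>{0..}. (\<Sum>k\<in>K. c k * h k r) * ennreal (exp (- r\<^sup>2 / 2) * r ^ (DIM('a) - 1)) \<partial>lborel)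
    = (\<integral>\<^sup>+r. (\<Sum>k\<in>K. c k * (h k r * ?v r)) \<partial>lborel)"
    by (simp add: sum_distrib_right mult.assoc)
  also have "\<dots> = (\<Sum>k\<in>K. c k * (\<integral>\<^sup>+r. h k r * ?v r \<partial>lborel))"
    by (subst nn_integral_sum) (auto simp: nn_integral_cmult intro!: sum.cong)
  finally show ?thesis
    by (simp add: radial_def sum_distrib_left mult_ac)
qed

text \<open>
  Differentiating the local Steiner formula in the tangent of the angle gives the law of that
  tangent away from the two extreme cases. The part with vanishing projection to the dual cone is
  the parallel set of angle \<open>0\<close>; only the coefficient of index \<open>DIM('a)\<close>, which is constant \<open>1\<close>,
  survives there, and it is subtracted before differentiating.
\<close>
lemma tangent_law:
  fixes C :: "'a::euclidean_space set"
  assumes d: "2 \<le> DIM('a)" and C: "closed C" "convex_cone C" and \<Omega>: "conic_support_measures C \<Omega>"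
    and \<eta>: "\<eta> \<in> biconic_sets" and h[measurable]: "h \<in> borel_measurable borel"
  defines "P \<equiv> closest_point C" and "Q \<equiv> closest_point (dual_cone C)"
  shows "(\<integral>\<^sup>+x\<in>{x. (P x, Q x) \<in> \<eta> \<and> P x \<noteq> 0 \<and> Q x \<noteq> 0}. h (norm (Q x) / norm (P x)) \<partial>gaussian)
    = (\<Sum>k=1..DIM('a) - 1. emeasure (\<Omega> k) \<eta> *
        (ennreal (omega k * omega (DIM('a) - k) / omega DIM('a)) *
        (\<integral>\<^sup>+t\<in>{0..}. h t * ennreal (t ^ (DIM('a) - k - 1) / sqrt (1 + t\<^sup>2) ^ DIM('a)) \<partial>lborel)))"
    and "emeasure gaussian {x. (P x, Q x) \<in> \<eta> \<and> P x \<noteq> 0 \<and> Q x = 0} = emeasure (\<Omega> DIM('a)) \<eta>"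
proof -
  let ?d = "DIM('a)" and ?K = "{1..DIM('a) - 1}"
  interpret G: prob_space "gaussian :: 'a measure" by (rule prob_space_gaussian)
  have [measurable]: "P \<in> borel_measurable borel" "Q \<in> borel_measurable borel"
    unfolding P_def Q_def using closest_point_measurable C dual_cone_closed dual_cone_convex_cone by blast+
  have [measurable]: "\<eta> \<in> sets (borel \<Otimes>\<^sub>M borel)"
    unfolding borel_prod using \<eta> by (simp add: biconic_sets_def)
  define A where "A = {x. (P x, Q x) \<in> \<eta>}"
  define D where "D = {x. (P x, Q x) \<in> \<eta> \<and> P x \<noteq> 0 \<and> Q x \<noteq> 0}"
  define E where "E = {x. (P x, Q x) \<in> \<eta> \<and> P x \<noteq> 0 \<and> Q x = 0}"
  have [measurable]: "D \<in> sets borel" "E \<in> sets borel" unfolding D_def E_def by measurable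
  define w where "w k = measure (\<Omega> k) \<eta>" for k
  define c where "c k = omega k * omega (?d - k) / omega ?d" for k
  have em: "emeasure (\<Omega> k) \<eta> = ennreal (w k)" if "k \<le> ?d" for k
    using \<Omega> that unfolding conic_support_measures_def w_def
    by (intro finite_measure.emeasure_eq_measure) auto
  have w0: "w k \<ge> 0" for k by (simp add: w_def)
  have c0: "c k \<ge> 0" if "k \<in> ?K" for k
  proof -
    have "0 < k" "0 < ?d - k" using that by auto
    from omega_pos[OF this(1)] omega_pos[OF this(2)] omega_pos[of ?d] show ?thesis
      by (simp add: c_def)
  qed
  have "\<exists>G. (\<forall>t. (G has_real_derivative t ^ (?d - k - 1) / sqrt (1 + t\<^sup>2) ^ ?d) (at t)) \<and>
      (\<forall>a\<ge>0. G a = integral {0..arctan a} (\<lambda>\<phi>. cos \<phi> ^ (k - 1) * sin \<phi> ^ (?d - k - 1)))"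
    if "k \<in> ?K" for k
  proof -
    have e: "k - 1 + (?d - k - 1) + 2 = ?d" using that d by auto
    obtain G where "\<And>t. (G has_real_derivative t ^ (?d - k - 1) / sqrt (1 + t\<^sup>2) ^ (k - 1 + (?d - k - 1) + 2)) (at t)"
      "\<And>a. 0 \<le> a \<Longrightarrow> G a = integral {0..arctan a} (\<lambda>\<phi>. cos \<phi> ^ (k - 1) * sin \<phi> ^ (?d - k - 1))"
      using sin_cos_integral_arctan[where i="k - 1" and j="?d - k - 1"] by blast
    then show ?thesis unfolding e by blast
  qed
  then have "\<exists>G. \<forall>k\<in>?K. (\<forall>t. (G k has_real_derivative t ^ (?d - k - 1) / sqrt (1 + t\<^sup>2) ^ ?d) (at t)) \<and>
      (\<forall>a\<ge>0. G k a = integral {0..arctan a} (\<lambda>\<phi>. cos \<phi> ^ (k - 1) * sin \<phi> ^ (?d - k - 1)))"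
    by (intro bchoice ballI)
  then obtain G where G: "\<And>k t. k \<in> ?K \<Longrightarrow> (G k has_real_derivative t ^ (?d - k - 1) / sqrt (1 + t\<^sup>2) ^ ?d) (at t)"
    and Gint: "\<And>k a. k \<in> ?K \<Longrightarrow> 0 \<le> a \<Longrightarrow> G k a = integral {0..arctan a} (\<lambda>\<phi>. cos \<phi> ^ (k - 1) * sin \<phi> ^ (?d - k - 1))"
    by blast
  have G0: "G k 0 = 0" if "k \<in> ?K" for k using Gint[OF that, of 0] by simp
  have steiner: "measure gaussian {x. (P x, Q x) \<in> \<eta> \<and> P x \<noteq> 0 \<and> norm (Q x) \<le> a * norm (P x)}
     = (\<Sum>k\<in>?K. w k * c k * G k a) + w ?d" if a: "0 \<le> a" for a
  proof -
    have "{x. (P x, Q x) \<in> \<eta> \<and> P x \<noteq> 0 \<and> norm (Q x) \<le> a * norm (P x)}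
        = angular_parallel_set (arctan a) C \<eta>"
      using angular_dist_le_arctan_iff[OF C a] by (auto simp: angular_parallel_set_def P_def Q_def)
    then have "measure gaussian {x. (P x, Q x) \<in> \<eta> \<and> P x \<noteq> 0 \<and> norm (Q x) \<le> a * norm (P x)}
        = (\<Sum>k=1..?d. steiner_coeff ?d k (arctan a) * w k)"
      using local_steiner_formula[OF C \<Omega> \<eta>, of "arctan a"] a arctan_ubound[of a] by (simp add: w_def)
    also have "{1..?d} = insert ?d ?K" using d by auto
    also have "(\<Sum>k\<in>insert ?d ?K. steiner_coeff ?d k (arctan a) * w k)
        = w ?d + (\<Sum>k\<in>?K. steiner_coeff ?d k (arctan a) * w k)"
      using d by (subst sum.insert) (auto simp: steiner_coeff_def)
    also have "(\<Sum>k\<in>?K. steiner_coeff ?d k (arctan a) * w k) = (\<Sum>k\<in>?K. w k * c k * G k a)"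
      using d a by (intro sum.cong refl) (auto simp: steiner_coeff_def c_def Gint)
    finally show ?thesis by simp
  qed
  have E0: "E = {x. (P x, Q x) \<in> \<eta> \<and> P x \<noteq> 0 \<and> norm (Q x) \<le> 0 * norm (P x)}"
    by (auto simp: E_def)
  have mE: "measure gaussian E = w ?d" unfolding E0 steiner[OF order_refl] by (simp add: G0)
  then show "emeasure gaussian {x. (P x, Q x) \<in> \<eta> \<and> P x \<noteq> 0 \<and> Q x = 0} = emeasure (\<Omega> ?d) \<eta>"
    unfolding E_def[symmetric] by (simp add: em G.emeasure_eq_measure)
  have cdf: "emeasure gaussian (D \<inter> {x. norm (Q x) / norm (P x) \<le> a}) = ennreal (\<Sum>k\<in>?K. w k * c k * G k a)"
    if a: "0 \<le> a" for a
  proof -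
    have "D \<inter> {x. norm (Q x) / norm (P x) \<le> a}
        = {x. (P x, Q x) \<in> \<eta> \<and> P x \<noteq> 0 \<and> norm (Q x) \<le> a * norm (P x)} - E"
      by (auto simp: D_def E_def divide_le_eq)
    also have "measure gaussian \<dots> = (\<Sum>k\<in>?K. w k * c k * G k a)"
      using a by (subst G.finite_measure_Diff) (auto simp: steiner mE, auto simp: E_def)
    finally show ?thesis by (simp add: G.emeasure_eq_measure)
  qed
  have "(\<integral>\<^sup>+x\<in>D. h (norm (Q x) / norm (P x)) \<partial>gaussian)
     = (\<integral>\<^sup>+x. h (norm (Q x) / norm (P x)) \<partial>density gaussian (indicator D))"
    by (subst nn_integral_density) (auto simp: mult_ac)
  also have "\<dots> = (\<integral>\<^sup>+t\<in>{0..}. h t * ennreal (\<Sum>k\<in>?K. w k * c k * (t ^ (?d - k - 1) / sqrt (1 + t\<^sup>2) ^ ?d)) \<partial>lborel)"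
  proof (rule nn_integral_distribution_function[where G="\<lambda>a. \<Sum>k\<in>?K. w k * c k * G k a"])
    show "((\<lambda>a. \<Sum>k\<in>?K. w k * c k * G k a) has_real_derivative
       (\<Sum>k\<in>?K. w k * c k * (t ^ (?d - k - 1) / sqrt (1 + t\<^sup>2) ^ ?d))) (at t)" for t
      by (intro DERIV_sum DERIV_cmult G)
    show "(\<Sum>k\<in>?K. w k * c k * G k 0) = 0" by (simp add: G0)
    show "0 \<le> (\<Sum>k\<in>?K. w k * c k * (t ^ (?d - k - 1) / sqrt (1 + t\<^sup>2) ^ ?d))" if "0 \<le> t" for t
      using that c0 w0 by (intro sum_nonneg mult_nonneg_nonneg) auto
    show "emeasure (density gaussian (indicator D)) {x \<in> space (density gaussian (indicator D)). norm (Q x) / norm (P x) \<le> a}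
       = ennreal (\<Sum>k\<in>?K. w k * c k * G k a)" if "0 \<le> a" for a
      unfolding cdf[OF that, symmetric]
      by (subst emeasure_density) (auto simp: indicator_inter_arith[symmetric])
  qed auto
  also have "\<dots> = (\<integral>\<^sup>+t. (\<Sum>k\<in>?K. ennreal (w k) * (ennreal (c k) *
      (h t * ennreal (t ^ (?d - k - 1) / sqrt (1 + t\<^sup>2) ^ ?d) * indicator {0..} t))) \<partial>lborel)"
  proof (rule nn_integral_cong)
    fix t :: real
    show "h t * ennreal (\<Sum>k\<in>?K. w k * c k * (t ^ (?d - k - 1) / sqrt (1 + t\<^sup>2) ^ ?d)) * indicator {0..} t
      = (\<Sum>k\<in>?K. ennreal (w k) * (ennreal (c k) *
      (h t * ennreal (t ^ (?d - k - 1) / sqrt (1 + t\<^sup>2) ^ ?d) * indicator {0..} t)))"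
    proof (cases "0 \<le> t")
      case True
      have "ennreal (\<Sum>k\<in>?K. w k * c k * (t ^ (?d - k - 1) / sqrt (1 + t\<^sup>2) ^ ?d))
        = (\<Sum>k\<in>?K. ennreal (w k * c k * (t ^ (?d - k - 1) / sqrt (1 + t\<^sup>2) ^ ?d)))"
        using True c0 w0 by (intro sum_ennreal[symmetric] mult_nonneg_nonneg) auto
      also have "\<dots> = (\<Sum>k\<in>?K. ennreal (w k) * ennreal (c k) * ennreal (t ^ (?d - k - 1) / sqrt (1 + t\<^sup>2) ^ ?d))"
      proof (intro sum.cong refl)
        fix k assume k: "k \<in> ?K"
        have "0 \<le> w k * c k" "0 \<le> t ^ (?d - k - 1) / sqrt (1 + t\<^sup>2) ^ ?d"
          using True c0[OF k] w0[of k] by auto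
        then show "ennreal (w k * c k * (t ^ (?d - k - 1) / sqrt (1 + t\<^sup>2) ^ ?d))
            = ennreal (w k) * ennreal (c k) * ennreal (t ^ (?d - k - 1) / sqrt (1 + t\<^sup>2) ^ ?d)"
          by (simp only: ennreal_mult w0 c0[OF k])
      qed
      finally show ?thesis using True by (simp add: sum_distrib_left mult_ac)
    qed simp
  qed
  also have "\<dots> = (\<Sum>k\<in>?K. ennreal (w k) * (ennreal (c k) *
      (\<integral>\<^sup>+t\<in>{0..}. h t * ennreal (t ^ (?d - k - 1) / sqrt (1 + t\<^sup>2) ^ ?d) \<partial>lborel)))"
    by (subst nn_integral_sum) (auto simp: nn_integral_cmult intro!: sum.cong)
  also have "\<dots> = (\<Sum>k\<in>?K. emeasure (\<Omega> k) \<eta> * (ennreal (omega k * omega (?d - k) / omega ?d) *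
        (\<integral>\<^sup>+t\<in>{0..}. h t * ennreal (t ^ (?d - k - 1) / sqrt (1 + t\<^sup>2) ^ ?d) \<partial>lborel)))"
  proof (intro sum.cong refl)
    fix k assume "k \<in> ?K"
    then have "k \<le> ?d" by auto
    from em[OF this] show "ennreal (w k) * (ennreal (c k) *
        (\<integral>\<^sup>+t\<in>{0..}. h t * ennreal (t ^ (?d - k - 1) / sqrt (1 + t\<^sup>2) ^ ?d) \<partial>lborel))
      = emeasure (\<Omega> k) \<eta> * (ennreal (omega k * omega (?d - k) / omega ?d) *
        (\<integral>\<^sup>+t\<in>{0..}. h t * ennreal (t ^ (?d - k - 1) / sqrt (1 + t\<^sup>2) ^ ?d) \<partial>lborel))"
      by (simp only: c_def)
  qed
  finally show "(\<integral>\<^sup>+x\<in>{x. (P x, Q x) \<in> \<eta> \<and> P x \<noteq> 0 \<and> Q x \<noteq> 0}. h (norm (Q x) / norm (P x)) \<partial>gaussian)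
    = (\<Sum>k\<in>?K. emeasure (\<Omega> k) \<eta> * (ennreal (omega k * omega (?d - k) / omega ?d) *
        (\<integral>\<^sup>+t\<in>{0..}. h t * ennreal (t ^ (?d - k - 1) / sqrt (1 + t\<^sup>2) ^ ?d) \<partial>lborel)))"
    unfolding D_def .
qed

text \<open>
  The points whose pair of projections lies in \<open>\<eta>\<close> are split into three cones, according to whether
  the projection to \<open>C\<close> vanishes, only the one to the dual cone vanishes, or neither does. On the
  first two the integrand depends on the norm alone. On the third both norms are functions
  of \<open>norm x\<close> and the tangent of the angular distance, which are independent.
\<close>
lemma projection_integral_decomposition:
  fixes C :: "'a::euclidean_space set" and F :: "real \<times> real \<Rightarrow> ennreal"
  assumes d: "2 \<le> DIM('a)" and C: "closed C" "convex_cone C" and \<Omega>: "conic_support_measures C \<Omega>"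
    and \<eta>: "\<eta> \<in> biconic_sets" and F[measurable]: "F \<in> borel_measurable (borel \<Otimes>\<^sub>M borel)"
  shows "projection_integral F C \<eta> = radial TYPE('a) (\<lambda>s. F (0, s)) * emeasure (\<Omega> 0) \<eta>
    + (\<Sum>k=1..DIM('a) - 1. biradial DIM('a) k F * emeasure (\<Omega> k) \<eta>)
    + radial TYPE('a) (\<lambda>r. F (r, 0)) * emeasure (\<Omega> DIM('a)) \<eta>"
proof -
  let ?d = "DIM('a)" and ?K = "{1..DIM('a) - 1}"
  interpret G: prob_space "gaussian :: 'a measure" by (rule prob_space_gaussian)
  define P Q where "P = closest_point C" and "Q = closest_point (dual_cone C)"
  have [measurable]: "P \<in> borel_measurable borel" "Q \<in> borel_measurable borel"
    unfolding P_def Q_def using closest_point_measurable C dual_cone_closed dual_cone_convex_cone by blast+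
  have [measurable]: "\<eta> \<in> sets (borel \<Otimes>\<^sub>M borel)"
    unfolding borel_prod using \<eta> by (simp add: biconic_sets_def)
  have PQ_scale: "P (c *\<^sub>R x) = c *\<^sub>R P x" "Q (c *\<^sub>R x) = c *\<^sub>R Q x" if "c > 0" for c x
    unfolding P_def Q_def using closest_point_cone_scaleR[OF C that]
      closest_point_cone_scaleR[OF dual_cone_closed dual_cone_convex_cone that] by this+
  have \<eta>_scale: "(c *\<^sub>R P x, c *\<^sub>R Q x) \<in> \<eta>" if "c > 0" "(P x, Q x) \<in> \<eta>" for c x
    using \<eta> that by (auto simp: biconic_sets_def)
  have norm: "(norm x)\<^sup>2 = (norm (P x))\<^sup>2 + (norm (Q x))\<^sup>2" for x
    unfolding P_def Q_def by (rule norm_sq_moreau[OF C])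
  define A0 where "A0 = {x. (P x, Q x) \<in> \<eta> \<and> P x = 0}"
  define D where "D = {x. (P x, Q x) \<in> \<eta> \<and> P x \<noteq> 0 \<and> Q x \<noteq> 0}"
  define E where "E = {x. (P x, Q x) \<in> \<eta> \<and> P x \<noteq> 0 \<and> Q x = 0}"
  have [measurable]: "A0 \<in> sets borel" "D \<in> sets borel" "E \<in> sets borel"
    unfolding A0_def D_def E_def by measurable
  have cone: "c *\<^sub>R x \<in> A0" if "c > 0" "x \<in> A0" for c x using that by (auto simp: A0_def PQ_scale \<eta>_scale dest: \<eta>_scale)
  have coneD: "c *\<^sub>R x \<in> D" if "c > 0" "x \<in> D" for c x using that by (auto simp: D_def PQ_scale \<eta>_scale)
  have coneE: "c *\<^sub>R x \<in> E" if "c > 0" "x \<in> E" for c x using that by (auto simp: E_def PQ_scale dest: \<eta>_scale)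
  have "projection_integral F C \<eta> = (\<integral>\<^sup>+x. F (0, norm x) * indicator A0 x
      + (F (norm (P x), norm (Q x)) * indicator D x + F (norm x, 0) * indicator E x) \<partial>gaussian)"
    unfolding projection_integral_def P_def[symmetric] Q_def[symmetric]
  proof (rule nn_integral_cong)
    fix x
    have "norm (Q x) = norm x" if "P x = 0" using norm[of x] that by simp
    moreover have "norm (P x) = norm x" if "Q x = 0" using norm[of x] that by simp
    ultimately show "F (norm (P x), norm (Q x)) * indicator \<eta> (P x, Q x) = F (0, norm x) * indicator A0 x
      + (F (norm (P x), norm (Q x)) * indicator D x + F (norm x, 0) * indicator E x)"
      by (auto simp: A0_def D_def E_def indicator_def)
  qed
  also have "\<dots> = (\<integral>\<^sup>+x\<in>A0. F (0, norm x) \<partial>gaussian)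
      + ((\<integral>\<^sup>+x\<in>D. F (norm (P x), norm (Q x)) \<partial>gaussian) + (\<integral>\<^sup>+x\<in>E. F (norm x, 0) \<partial>gaussian))"
    by (subst nn_integral_add, measurable)+
  also have "(\<integral>\<^sup>+x\<in>A0. F (0, norm x) \<partial>gaussian) = emeasure gaussian A0 * radial TYPE('a) (\<lambda>s. F (0, s))"
    by (rule gaussian_cone_radial[of A0 "\<lambda>s. F (0, s)"]) (auto intro: cone)
  also have "(\<integral>\<^sup>+x\<in>E. F (norm x, 0) \<partial>gaussian) = emeasure gaussian E * radial TYPE('a) (\<lambda>r. F (r, 0))"
    by (rule gaussian_cone_radial[of E "\<lambda>r. F (r, 0)"]) (auto intro: coneE)
  also have "emeasure gaussian A0 = emeasure (\<Omega> 0) \<eta>"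
  proof -
    have "measure (\<Omega> 0) \<eta> = measure gaussian A0"
      using \<Omega> \<eta> unfolding conic_support_measures_def A0_def P_def Q_def by (simp add: conj_commute)
    moreover have "emeasure (\<Omega> 0) \<eta> = measure (\<Omega> 0) \<eta>"
      using \<Omega> unfolding conic_support_measures_def by (intro finite_measure.emeasure_eq_measure) auto
    ultimately show ?thesis by (simp add: G.emeasure_eq_measure)
  qed
  also have "emeasure gaussian E = emeasure (\<Omega> ?d) \<eta>"
    unfolding E_def P_def Q_def by (rule tangent_law(2)[OF d C \<Omega> \<eta>, of "\<lambda>_. 0"]) simp
  also have "(\<integral>\<^sup>+x\<in>D. F (norm (P x), norm (Q x)) \<partial>gaussian)
     = (\<Sum>k\<in>?K. biradial ?d k F * emeasure (\<Omega> k) \<eta>)"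
  proof -
    define u where "u x = norm (Q x) / norm (P x)" for x
    define F' where "F' = (\<lambda>(R, t). F (R / sqrt (1 + t\<^sup>2), R * t / sqrt (1 + t\<^sup>2)))"
    have [measurable]: "u \<in> borel_measurable borel" unfolding u_def by measurable
    have F'[measurable]: "F' \<in> borel_measurable (borel \<Otimes>\<^sub>M borel)" unfolding F'_def by measurable
    have "(\<integral>\<^sup>+x\<in>D. F (norm (P x), norm (Q x)) \<partial>gaussian) = (\<integral>\<^sup>+x\<in>D. F' (norm x, u x) \<partial>gaussian)"
    proof (rule nn_integral_cong)
      fix x
      show "F (norm (P x), norm (Q x)) * indicator D x = F' (norm x, u x) * indicator D x"
      proof (cases "x \<in> D")
        case True
        then have p: "norm (P x) > 0" by (simp add: D_def)
        have "(norm x)\<^sup>2 \<noteq> 0" using p by (simp add: norm[of x] add_nonneg_eq_0_iff)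
        then have nx: "norm x > 0" by simp
        have "1 + (u x)\<^sup>2 = (norm x / norm (P x))\<^sup>2"
          using p by (simp add: u_def norm[of x] power_divide field_simps)
        then have s: "sqrt (1 + (u x)\<^sup>2) = norm x / norm (P x)"
          by (simp add: real_sqrt_abs)
        have "norm x / sqrt (1 + (u x)\<^sup>2) = norm (P x)" "norm x * u x / sqrt (1 + (u x)\<^sup>2) = norm (Q x)"
          unfolding s using p nx by (simp_all add: u_def)
        then show ?thesis by (simp add: F'_def)
      qed simp
    qed
    also have "\<dots> = radial TYPE('a) (\<lambda>R. \<integral>\<^sup>+x\<in>D. F' (R, u x) \<partial>gaussian)"
      by (rule gaussian_cone_independence) (auto intro: coneD simp: u_def PQ_scale)
    also have "\<dots> = radial TYPE('a) (\<lambda>R. \<Sum>k\<in>?K. emeasure (\<Omega> k) \<eta> *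
        ennreal (omega k * omega (?d - k) / omega ?d) *
        (\<integral>\<^sup>+t\<in>{0..}. F' (R, t) * ennreal (t ^ (?d - k - 1) / sqrt (1 + t\<^sup>2) ^ ?d) \<partial>lborel))"
    proof (rule radial_cong)
      fix R :: real
      have "(\<lambda>t. F' (R, t)) \<in> borel_measurable borel" by measurable
      from tangent_law(1)[OF d C \<Omega> \<eta> this]
      show "(\<integral>\<^sup>+x\<in>D. F' (R, u x) \<partial>gaussian) = (\<Sum>k\<in>?K. emeasure (\<Omega> k) \<eta> *
        ennreal (omega k * omega (?d - k) / omega ?d) *
        (\<integral>\<^sup>+t\<in>{0..}. F' (R, t) * ennreal (t ^ (?d - k - 1) / sqrt (1 + t\<^sup>2) ^ ?d) \<partial>lborel))"
        unfolding D_def u_def P_def Q_def mult.assoc .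
    qed
    also have "\<dots> = (\<Sum>k\<in>?K. emeasure (\<Omega> k) \<eta> * ennreal (omega k * omega (?d - k) / omega ?d) *
        radial TYPE('a) (\<lambda>R. \<integral>\<^sup>+t\<in>{0..}. F' (R, t) * ennreal (t ^ (?d - k - 1) / sqrt (1 + t\<^sup>2) ^ ?d) \<partial>lborel))"
      by (rule radial_cmult_sum) auto
    also have "\<dots> = (\<Sum>k\<in>?K. biradial ?d k F * emeasure (\<Omega> k) \<eta>)"
    proof (intro sum.cong refl)
      fix k assume "k \<in> ?K"
      then have "1 \<le> k" "k < ?d" using d by auto
      from biradial_polar[OF F this]
      show "emeasure (\<Omega> k) \<eta> * ennreal (omega k * omega (?d - k) / omega ?d) *
        radial TYPE('a) (\<lambda>R. \<integral>\<^sup>+t\<in>{0..}. F' (R, t) * ennreal (t ^ (?d - k - 1) / sqrt (1 + t\<^sup>2) ^ ?d) \<partial>lborel)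
        = biradial ?d k F * emeasure (\<Omega> k) \<eta>"
        by (simp add: F'_def mult_ac)
    qed
    finally show ?thesis .
  qed
  finally show ?thesis by (simp add: mult_ac add_ac)
qed

section \<open>Linear subspaces\<close>

text \<open>
  The two extreme dimensions are radial integrals, since one of the projections is the identity; in
  between, the Gaussian density splits over \<open>L\<close> and its orthogonal complement.
\<close>
lemma projection_integral_subspace:
  fixes L :: "'a::euclidean_space set" and F :: "real \<times> real \<Rightarrow> ennreal"
  assumes L: "subspace L" and F[measurable]: "F \<in> borel_measurable (borel \<Otimes>\<^sub>M borel)"
  shows "dim L = 0 \<Longrightarrow> projection_integral F L UNIV = radial TYPE('a) (\<lambda>s. F (0, s))"
    and "dim L = DIM('a) \<Longrightarrow> projection_integral F L UNIV = radial TYPE('a) (\<lambda>r. F (r, 0))"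
    and "0 < dim L \<Longrightarrow> dim L < DIM('a) \<Longrightarrow> projection_integral F L UNIV = biradial DIM('a) (dim L) F"
proof -
  let ?d = "DIM('a)" and ?P = "closest_point L" and ?Q = "closest_point (dual_cone L)"
  have cc: "closed L" "convex_cone L"
    using L by (auto simp: closed_subspace convex_cone_iff subspace_def)
  have Q: "?Q x = x - ?P x" for x by (rule moreau_decomposition[OF cc])
  have radial: "(\<integral>\<^sup>+x. h (norm x) \<partial>(gaussian :: 'a measure)) = radial TYPE('a) h"
    if "h \<in> borel_measurable borel" for h
    using gaussian_cone_radial[of UNIV h] that by (simp add: emeasure_gaussian_UNIV)
  show "projection_integral F L UNIV = radial TYPE('a) (\<lambda>s. F (0, s))" if "dim L = 0"
  proof -
    have "?P x = 0" for x
      using closest_point_in_set[OF cc(1), of x] that subspace_0[OF L] by (auto simp: dim_eq_0)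
    then show ?thesis unfolding projection_integral_def Q by (simp add: radial[of "\<lambda>s. F (0, s)"])
  qed
  show "projection_integral F L UNIV = radial TYPE('a) (\<lambda>r. F (r, 0))" if "dim L = ?d"
  proof -
    have "L = UNIV" using that L dim_eq_full[of L] by (metis span_eq_iff)
    then have "?P x = x" for x by (simp add: closest_point_self)
    then show ?thesis unfolding projection_integral_def Q by (simp add: radial[of "\<lambda>r. F (r, 0)"])
  qed
  show "projection_integral F L UNIV = biradial ?d (dim L) F" if k: "0 < dim L" "dim L < ?d"
  proof -
    let ?k = "dim L"
    define K where "K = (2 * pi) powr (- real ?d / 2)"
    have K: "K > 0" by (simp add: K_def)
    have [measurable]: "?P \<in> borel_measurable borel" "?Q \<in> borel_measurable borel"
      using closest_point_measurable cc dual_cone_closed dual_cone_convex_cone by blast+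
    define H where "H = (\<lambda>(r, s). ennreal K * (F (r, s) * ennreal (exp (- (r\<^sup>2 + s\<^sup>2) / 2))))"
    have H[measurable]: "H \<in> borel_measurable (borel \<Otimes>\<^sub>M borel)" unfolding H_def by measurable
    have "projection_integral F L UNIV = (\<integral>\<^sup>+x. H (norm (?P x), norm (?Q x)) \<partial>lborel)"
    proof -
      have "projection_integral F L UNIV = (\<integral>\<^sup>+x. ennreal (K * exp (- (norm x)\<^sup>2 / 2)) * F (norm (?P x), norm (?Q x)) \<partial>lborel)"
        unfolding projection_integral_def gaussian_def K_def by (subst nn_integral_density) auto
      also have "\<dots> = (\<integral>\<^sup>+x. H (norm (?P x), norm (?Q x)) \<partial>lborel)"
      proof (rule nn_integral_cong)
        fix x
        show "ennreal (K * exp (- (norm x)\<^sup>2 / 2)) * F (norm (?P x), norm (?Q x)) = H (norm (?P x), norm (?Q x))"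
          unfolding H_def prod.case norm_sq_moreau[OF cc, of x, symmetric]
          using K by (simp add: ennreal_mult' mult_ac)
      qed
      finally show ?thesis .
    qed
    also have "\<dots> = (\<integral>\<^sup>+r\<in>{0..}. (\<integral>\<^sup>+s\<in>{0..}. H (r, s) *
         ennreal (omega (?d - ?k) * s ^ (?d - ?k - 1)) \<partial>lborel) *
         ennreal (omega ?k * r ^ (?k - 1)) \<partial>lborel)"
      by (rule nn_integral_lborel_subspace[OF L k H])
    also have "\<dots> = (\<integral>\<^sup>+r. ennreal (omega ?k * omega (?d - ?k) * K) *
       ((\<integral>\<^sup>+s\<in>{0..}. F (r, s) *
        ennreal (exp (- (r\<^sup>2 + s\<^sup>2) / 2) * r ^ (?k - 1) * s ^ (?d - ?k - 1)) \<partial>lborel) * indicator {0..} r) \<partial>lborel)"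
    proof (rule nn_integral_cong)
      fix r :: real
      show "(\<integral>\<^sup>+s\<in>{0..}. H (r, s) *
         ennreal (omega (?d - ?k) * s ^ (?d - ?k - 1)) \<partial>lborel) *
         ennreal (omega ?k * r ^ (?k - 1)) * indicator {0..} r
        = ennreal (omega ?k * omega (?d - ?k) * K) *
       ((\<integral>\<^sup>+s\<in>{0..}. F (r, s) *
        ennreal (exp (- (r\<^sup>2 + s\<^sup>2) / 2) * r ^ (?k - 1) * s ^ (?d - ?k - 1)) \<partial>lborel) * indicator {0..} r)"
      proof (cases "0 \<le> r")
        case True
        have om: "omega ?k > 0" "omega (?d - ?k) > 0" using k by (auto intro: omega_pos)
        have "(\<integral>\<^sup>+s\<in>{0..}. H (r, s) * ennreal (omega (?d - ?k) * s ^ (?d - ?k - 1)) \<partial>lborel) *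
           ennreal (omega ?k * r ^ (?k - 1))
          = (\<integral>\<^sup>+s. (H (r, s) * ennreal (omega (?d - ?k) * s ^ (?d - ?k - 1)) * indicator {0..} s) *
           ennreal (omega ?k * r ^ (?k - 1)) \<partial>lborel)"
          by (rule nn_integral_multc[symmetric]) measurable
        also have "\<dots> = (\<integral>\<^sup>+s. ennreal (omega ?k * omega (?d - ?k) * K) * (F (r, s) *
          ennreal (exp (- (r\<^sup>2 + s\<^sup>2) / 2) * r ^ (?k - 1) * s ^ (?d - ?k - 1)) * indicator {0..} s) \<partial>lborel)"
        proof (rule nn_integral_cong)
          fix s :: real
          define e where "e = exp (- (r\<^sup>2 + s\<^sup>2) / 2)"
          have e: "e \<ge> 0" by (simp add: e_def)
          show "(H (r, s) * ennreal (omega (?d - ?k) * s ^ (?d - ?k - 1)) * indicator {0..} s) *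
             ennreal (omega ?k * r ^ (?k - 1)) = ennreal (omega ?k * omega (?d - ?k) * K) * (F (r, s) *
             ennreal (exp (- (r\<^sup>2 + s\<^sup>2) / 2) * r ^ (?k - 1) * s ^ (?d - ?k - 1)) * indicator {0..} s)"
            unfolding H_def e_def[symmetric] prod.case
            using True K om e by (cases "0 \<le> s") (simp_all add: ennreal_mult mult_ac)
        qed
        also have "\<dots> = ennreal (omega ?k * omega (?d - ?k) * K) * (\<integral>\<^sup>+s\<in>{0..}. F (r, s) *
          ennreal (exp (- (r\<^sup>2 + s\<^sup>2) / 2) * r ^ (?k - 1) * s ^ (?d - ?k - 1)) \<partial>lborel)"
          by (rule nn_integral_cmult) measurable
        finally show ?thesis using True by simp
      qed simp
    qed
    also have "\<dots> = ennreal (omega ?k * omega (?d - ?k) * K) * (\<integral>\<^sup>+r\<in>{0..}. (\<integral>\<^sup>+s\<in>{0..}. F (r, s) *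
        ennreal (exp (- (r\<^sup>2 + s\<^sup>2) / 2) * r ^ (?k - 1) * s ^ (?d - ?k - 1)) \<partial>lborel) \<partial>lborel)"
      by (rule nn_integral_cmult) measurable
    finally show ?thesis
      by (simp add: biradial_def K_def powr_minus_divide)
  qed
qed

theorem theorem3p4:
  fixes C :: "'a::euclidean_space set"
    and \<Omega> :: "nat \<Rightarrow> ('a \<times> 'a) measure"
    and f :: "real \<times> real \<Rightarrow> real"
    and L :: "nat \<Rightarrow> 'a set"
  assumes dim: "2 \<le> DIM('a)"
    and C: "closed C" "convex_cone C"
    and \<Omega>: "conic_support_measures C \<Omega>"
    and f_measurable: "f \<in> borel_measurable (restrict_space borel ({0..} \<times> {0..}))"
    and f_nonneg: "\<And>a b. 0 \<le> a \<Longrightarrow> 0 \<le> b \<Longrightarrow> 0 \<le> f (a, b)"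
    and finite: "\<And>\<eta>. \<eta> \<in> biconic_sets \<Longrightarrow> phi f C \<eta> < \<infinity>"
    and L: "\<And>k. k \<le> DIM('a) \<Longrightarrow> subspace (L k) \<and> dim (L k) = k"
  shows "(\<forall>\<eta>\<in>biconic_sets.
      phi f C \<eta> = (\<Sum>k\<le>DIM('a). phi f (L k) UNIV * emeasure (\<Omega> k) \<eta>)) \<and>
    (\<forall>k\<in>{1..DIM('a) - 1}. phi f (L k) UNIV =
      ennreal (omega k * omega (DIM('a) - k) / (2 * pi) powr (real DIM('a) / 2)) *
      (\<integral>\<^sup>+r\<in>{0..}. (\<integral>\<^sup>+s\<in>{0..}.
        ennreal (f (r\<^sup>2, s\<^sup>2) * exp (- (r\<^sup>2 + s\<^sup>2) / 2) * r ^ (k - 1) * s ^ (DIM('a) - k - 1))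
        \<partial>lborel) \<partial>lborel)) \<and>
    phi f (L 0) UNIV =
      ennreal (omega DIM('a) / (2 * pi) powr (real DIM('a) / 2)) *
      (\<integral>\<^sup>+s\<in>{0..}. ennreal (f (0, s\<^sup>2) * exp (- s\<^sup>2 / 2) * s ^ (DIM('a) - 1)) \<partial>lborel) \<and>
    phi f (L DIM('a)) UNIV =
      ennreal (omega DIM('a) / (2 * pi) powr (real DIM('a) / 2)) *
      (\<integral>\<^sup>+r\<in>{0..}. ennreal (f (r\<^sup>2, 0) * exp (- r\<^sup>2 / 2) * r ^ (DIM('a) - 1)) \<partial>lborel)"
proof -
  let ?d = "DIM('a)"
  define F where "F = (\<lambda>(r, s). ennreal (f (r\<^sup>2, s\<^sup>2)))"
  have F: "F \<in> borel_measurable (borel \<Otimes>\<^sub>M borel)"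
  proof -
    have "(\<lambda>(r, s). (r\<^sup>2, s\<^sup>2) :: real \<times> real) \<in> borel \<Otimes>\<^sub>M borel \<rightarrow>\<^sub>M restrict_space borel ({0..} \<times> {0..})"
      by (intro measurable_restrict_space2) (auto simp: borel_prod[symmetric])
    from measurable_compose[OF this f_measurable]
    show ?thesis unfolding F_def case_prod_unfold by measurable
  qed
  have phi: "phi f X \<eta> = projection_integral F X \<eta>" for X :: "'a set" and \<eta>
    by (simp add: phi_def projection_integral_def F_def)
  have L0: "phi f (L 0) UNIV = radial TYPE('a) (\<lambda>s. F (0, s))"
    unfolding phi using L[of 0] projection_integral_subspace(1)[of "L 0", OF _ F] by simp
  have Ld: "phi f (L ?d) UNIV = radial TYPE('a) (\<lambda>r. F (r, 0))"
    unfolding phi using L[of ?d] projection_integral_subspace(2)[of "L ?d", OF _ F] by simp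
  have Lk: "phi f (L k) UNIV = biradial ?d k F" if "k \<in> {1..?d - 1}" for k
  proof -
    have "subspace (L k)" "dim (L k) = k" "0 < k" "k < ?d" using that dim L[of k] by auto
    then show ?thesis unfolding phi using projection_integral_subspace(3)[OF _ F, of "L k"] by simp
  qed
  have "phi f C \<eta> = (\<Sum>k\<le>?d. phi f (L k) UNIV * emeasure (\<Omega> k) \<eta>)" if \<eta>: "\<eta> \<in> biconic_sets" for \<eta>
  proof -
    have "{..?d} = insert 0 (insert ?d {1..?d - 1})" by auto
    then have "(\<Sum>k\<le>?d. phi f (L k) UNIV * emeasure (\<Omega> k) \<eta>)
      = phi f (L 0) UNIV * emeasure (\<Omega> 0) \<eta> + (phi f (L ?d) UNIV * emeasure (\<Omega> ?d) \<eta>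
        + (\<Sum>k\<in>{1..?d - 1}. phi f (L k) UNIV * emeasure (\<Omega> k) \<eta>))"
      using dim by simp
    also have "(\<Sum>k\<in>{1..?d - 1}. phi f (L k) UNIV * emeasure (\<Omega> k) \<eta>)
      = (\<Sum>k\<in>{1..?d - 1}. biradial ?d k F * emeasure (\<Omega> k) \<eta>)"
      using Lk by (intro sum.cong) auto
    also have "phi f (L 0) UNIV * emeasure (\<Omega> 0) \<eta> + (phi f (L ?d) UNIV * emeasure (\<Omega> ?d) \<eta>
        + (\<Sum>k\<in>{1..?d - 1}. biradial ?d k F * emeasure (\<Omega> k) \<eta>)) = phi f C \<eta>"
      unfolding L0 Ld unfolding phi projection_integral_decomposition[OF dim C \<Omega> \<eta> F] by (simp only: add_ac)
    finally show ?thesis ..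
  qed
  moreover have "phi f (L k) UNIV =
      ennreal (omega k * omega (DIM('a) - k) / (2 * pi) powr (real DIM('a) / 2)) *
      (\<integral>\<^sup>+r\<in>{0..}. (\<integral>\<^sup>+s\<in>{0..}.
        ennreal (f (r\<^sup>2, s\<^sup>2) * exp (- (r\<^sup>2 + s\<^sup>2) / 2) * r ^ (k - 1) * s ^ (DIM('a) - k - 1))
        \<partial>lborel) \<partial>lborel)" if "k \<in> {1..?d - 1}" for k
    unfolding Lk[OF that] biradial_def
    by (intro arg_cong2[where f="(*)"] nn_integral_cong refl)
       (auto simp: F_def indicator_def ennreal_mult'[symmetric] f_nonneg mult.assoc intro!: nn_integral_cong)
  moreover have "phi f (L 0) UNIV =
      ennreal (omega DIM('a) / (2 * pi) powr (real DIM('a) / 2)) *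
      (\<integral>\<^sup>+s\<in>{0..}. ennreal (f (0, s\<^sup>2) * exp (- s\<^sup>2 / 2) * s ^ (DIM('a) - 1)) \<partial>lborel)"
    unfolding L0 radial_def
    by (intro arg_cong2[where f="(*)"] nn_integral_cong refl)
       (simp add: F_def ennreal_mult'[symmetric] f_nonneg mult.assoc)
  moreover have "phi f (L DIM('a)) UNIV =
      ennreal (omega DIM('a) / (2 * pi) powr (real DIM('a) / 2)) *
      (\<integral>\<^sup>+r\<in>{0..}. ennreal (f (r\<^sup>2, 0) * exp (- r\<^sup>2 / 2) * r ^ (DIM('a) - 1)) \<partial>lborel)"
    unfolding Ld radial_def
    by (intro arg_cong2[where f="(*)"] nn_integral_cong refl)
       (simp add: F_def ennreal_mult'[symmetric] f_nonneg mult.assoc)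
  ultimately show ?thesis by blast
qed

end
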